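(* Let $\Gamma$ be a minimal connected weighted graph all of whose vertices are rational. Then the birational equivalence class of $\Gamma$ contains an infinite number of pairwise non-isomorphic minimal weighted graphs if and only if $\Gamma$ is not admissible modulo charm earrings and is different from the graphs $[[0]]$, $((3))$, $((4))$, and $((0,m))$ with $m\le 0$. In the opposite case, up to isomorphism $\Gamma$ is the unique minimal graph in its birational equivalence class.
   Context: Weighted graphs. A weighted graph is a nonempty finite graph (loops, cycles and multiple edges allowed) whose vertices carry integer weights, with a distinguished subset of vertices called rational; here all vertices are assumed rational. A $(-1)$-vertex (resp. $(0)$-vertex) is a rational vertex of weight $-1$ (resp. $0$). The degree of a vertex is the number of incident edges, loops counted twice. $[[w_1,\dots,w_n]]$ denotes the linear graph (chain) with $n$ consecutive vertices of weights $w_1,\dots,w_n$; $((w_1,\dots,w_n))$ denotes the circular graph (cycle) with $n$ cyclically ordered vertices of weights $w_1,\dots,w_n$ (for $n=1$: a single vertex with one loop; for $n=2$: two vertices joined by two edges). Blowups. The inner blowup in an edge $[v_1,v_2]$ (possibly $v_1=v_2$) adds a new rational vertex $v$ of weight $-1$, replaces the edge by two edges $[v_1,v]$, $[v,v_2]$, and decreases the weights of $v_1$ and $v_2$ by $1$ each if $v_1\ne v_2$, and the weight of $v_1$ by $4$ if $v_1=v_2$ (the edge is a loop). The outer blowup at a vertex $v$ adds a new rational vertex $v'$ of weight $-1$ and an edge $[v,v']$ and decreases the weight of $v$ by $1$. Blowdowns are the inverse modifications. Two weighted graphs are birationally equivalent if one is obtained from the other by a finite sequence of blowups, blowdowns and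 isomorphisms of weighted graphs. A graph is minimal if it contains no at most linear $(-1)$-vertex, where an at most linear vertex is a rational vertex of degree $\le 2$ with no incident loop. Segments. A branch vertex is a vertex that is non-rational or has degree $\ge 3$. A segment of $\Gamma$ is a connected component of the graph obtained by deleting all branch vertices together with all their incident edges; it is either linear (a chain) or circular (a cycle). In a minimal graph, a linear segment is admissible if all its weights are $\le -2$; a circular segment is admissible if either all its weights are $\le -2$, or it consists of a single vertex of weight $\le 2$ with a loop. A charm earring is a segment consisting of a single rational $(0)$-vertex of degree $2$ adjacent to a branch vertex via two edges. A minimal graph is admissible modulo charm earrings if every non-admissible segment of it is a charm earring. *)

theory Defs
  imports Main "HOL-Library.Uprod" "HOL-Library.Infinite_Typeclass"
begin

text \<open>
  Weighted multigraphs. An edge \<open>e\<close> has an unordered pair of endpoints \<open>ends G e\<close>; it is a loop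
  iff \<open>ends G e = Upair v v\<close>. Values of \<open>ends\<close> and \<open>weight\<close> outside \<open>edges G\<close> and \<open>verts G\<close>
  are irrelevant.
\<close>

record ('v, 'e) wgraph =
  verts :: "'v set"
  edges :: "'e set"
  ends :: "'e \<Rightarrow> 'v uprod"
  weight :: "'v \<Rightarrow> int"
  rational :: "'v set"

definition weighted_graph :: "('v, 'e) wgraph \<Rightarrow> bool" where
  "weighted_graph G \<longleftrightarrow>
     finite (verts G) \<and> verts G \<noteq> {} \<and> finite (edges G) \<and>
     (\<forall>e\<in>edges G. set_uprod (ends G e) \<subseteq> verts G) \<and> rational G \<subseteq> verts G"

definition isomorphic :: "('v, 'e) wgraph \<Rightarrow> ('w, 'f) wgraph \<Rightarrow> bool"  (infix "\<cong>" 50) where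
  "G \<cong> H \<longleftrightarrow> (\<exists>f g.
     bij_betw f (verts G) (verts H) \<and> bij_betw g (edges G) (edges H) \<and>
     (\<forall>e\<in>edges G. ends H (g e) = map_uprod f (ends G e)) \<and>
     (\<forall>v\<in>verts G. weight H (f v) = weight G v \<and> (f v \<in> rational H \<longleftrightarrow> v \<in> rational G)))"

definition loops_at :: "('v, 'e) wgraph \<Rightarrow> 'v \<Rightarrow> 'e set" where
  "loops_at G v = {e \<in> edges G. ends G e = Upair v v}"

text \<open>The second summand makes loops count twice.\<close>

definition degree :: "('v, 'e) wgraph \<Rightarrow> 'v \<Rightarrow> nat" where
  "degree G v = card {e \<in> edges G. v \<in> set_uprod (ends G e)} + card (loops_at G v)"

definition adjacent :: "('v, 'e) wgraph \<Rightarrow> 'v \<Rightarrow> 'v \<Rightarrow> bool" where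
  "adjacent G u v \<longleftrightarrow> (\<exists>e\<in>edges G. ends G e = Upair u v)"

definition connected_graph :: "('v, 'e) wgraph \<Rightarrow> bool" where
  "connected_graph G \<longleftrightarrow> (\<forall>u\<in>verts G. \<forall>v\<in>verts G. (adjacent G)\<^sup>*\<^sup>* u v)"

text \<open>The chain \<open>[[w\<^sub>1,\<dots>,w\<^sub>n]]\<close> and the cycle \<open>((w\<^sub>1,\<dots>,w\<^sub>n))\<close>, meaningful for nonempty lists.\<close>

definition chain :: "int list \<Rightarrow> (nat, nat) wgraph" where
  "chain ws =
     \<lparr> verts = {..<length ws},
       edges = {..<length ws - 1},
       ends = (\<lambda>i. Upair i (Suc i)),
       weight = (\<lambda>i. ws ! i),
       rational = {..<length ws} \<rparr>"

definition cycle :: "int list \<Rightarrow> (nat, nat) wgraph" where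
  "cycle ws =
     \<lparr> verts = {..<length ws},
       edges = {..<length ws},
       ends = (\<lambda>i. Upair i (Suc i mod length ws)),
       weight = (\<lambda>i. ws ! i),
       rational = {..<length ws} \<rparr>"


subsection \<open>Blowups and birational equivalence\<close>

definition inner_blowup :: "('v, 'e) wgraph \<Rightarrow> ('v, 'e) wgraph \<Rightarrow> bool" where
  "inner_blowup G H \<longleftrightarrow> (\<exists>e v1 v2 v e1 e2.
     e \<in> edges G \<and> ends G e = Upair v1 v2 \<and>
     v \<notin> verts G \<and> e1 \<notin> edges G \<and> e2 \<notin> edges G \<and> e1 \<noteq> e2 \<and>
     H = \<lparr> verts = insert v (verts G),
           edges = (edges G - {e}) \<union> {e1, e2},
           ends = (ends G)(e1 := Upair v1 v, e2 := Upair v v2),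
           weight =
             (if v1 \<noteq> v2
              then (weight G)(v1 := weight G v1 - 1, v2 := weight G v2 - 1, v := -1)
              else (weight G)(v1 := weight G v1 - 4, v := -1)),
           rational = insert v (rational G) \<rparr>)"

definition outer_blowup :: "('v, 'e) wgraph \<Rightarrow> ('v, 'e) wgraph \<Rightarrow> bool" where
  "outer_blowup G H \<longleftrightarrow> (\<exists>v v' e.
     v \<in> verts G \<and> v' \<notin> verts G \<and> e \<notin> edges G \<and>
     H = \<lparr> verts = insert v' (verts G),
           edges = insert e (edges G),
           ends = (ends G)(e := Upair v v'),
           weight = (weight G)(v := weight G v - 1, v' := -1),
           rational = insert v' (rational G) \<rparr>)"

definition blowup :: "('v, 'e) wgraph \<Rightarrow> ('v, 'e) wgraph \<Rightarrow> bool" where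
  "blowup G H \<longleftrightarrow> inner_blowup G H \<or> outer_blowup G H"

text \<open>
  The two disjuncts for \<open>blowup\<close> are blowups and blowdowns. The new vertices and edges are taken
  from the carrier types, so this is adequate when both types are infinite. Isomorphism steps
  absorb the choice of names and the values of \<open>ends\<close> and \<open>weight\<close> outside the carriers.
\<close>

definition birational_step :: "('v, 'e) wgraph \<Rightarrow> ('v, 'e) wgraph \<Rightarrow> bool" where
  "birational_step G H \<longleftrightarrow>
     weighted_graph G \<and> weighted_graph H \<and> (blowup G H \<or> blowup H G \<or> G \<cong> H)"

definition birational :: "('v, 'e) wgraph \<Rightarrow> ('v, 'e) wgraph \<Rightarrow> bool" where
  "birational = birational_step\<^sup>*\<^sup>*"

definition at_most_linear :: "('v, 'e) wgraph \<Rightarrow> 'v \<Rightarrow> bool" where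
  "at_most_linear G v \<longleftrightarrow>
     v \<in> verts G \<and> v \<in> rational G \<and> degree G v \<le> 2 \<and> loops_at G v = {}"

definition minimal :: "('v, 'e) wgraph \<Rightarrow> bool" where
  "minimal G \<longleftrightarrow> \<not> (\<exists>v. at_most_linear G v \<and> weight G v = -1)"


subsection \<open>Segments\<close>

definition branch_vertex :: "('v, 'e) wgraph \<Rightarrow> 'v \<Rightarrow> bool" where
  "branch_vertex G v \<longleftrightarrow> v \<in> verts G \<and> (v \<notin> rational G \<or> 3 \<le> degree G v)"

definition induced_subgraph :: "('v, 'e) wgraph \<Rightarrow> 'v set \<Rightarrow> ('v, 'e) wgraph" where
  "induced_subgraph G A =
     G \<lparr> verts := verts G \<inter> A,
         edges := {e \<in> edges G. set_uprod (ends G e) \<subseteq> A},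
         rational := rational G \<inter> A \<rparr>"

definition components :: "('v, 'e) wgraph \<Rightarrow> ('v, 'e) wgraph set" where
  "components G = {induced_subgraph G {v \<in> verts G. (adjacent G)\<^sup>*\<^sup>* u v} | u. u \<in> verts G}"

definition segments :: "('v, 'e) wgraph \<Rightarrow> ('v, 'e) wgraph set" where
  "segments G = components (induced_subgraph G {v. \<not> branch_vertex G v})"

definition is_linear :: "('v, 'e) wgraph \<Rightarrow> bool" where
  "is_linear S \<longleftrightarrow> (\<exists>ws. ws \<noteq> [] \<and> S \<cong> chain ws)"

definition is_circular :: "('v, 'e) wgraph \<Rightarrow> bool" where
  "is_circular S \<longleftrightarrow> (\<exists>ws. ws \<noteq> [] \<and> S \<cong> cycle ws)"

text \<open>A circular graph with a single vertex carries exactly one loop.\<close>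

definition admissible_segment :: "('v, 'e) wgraph \<Rightarrow> bool" where
  "admissible_segment S \<longleftrightarrow>
     (is_linear S \<and> (\<forall>v\<in>verts S. weight S v \<le> -2)) \<or>
     (is_circular S \<and>
       ((\<forall>v\<in>verts S. weight S v \<le> -2) \<or> (\<exists>v. verts S = {v} \<and> weight S v \<le> 2)))"

definition charm_earring :: "('v, 'e) wgraph \<Rightarrow> ('v, 'e) wgraph \<Rightarrow> bool" where
  "charm_earring G S \<longleftrightarrow> S \<in> segments G \<and>
     (\<exists>v. verts S = {v} \<and> v \<in> rational G \<and> weight G v = 0 \<and> degree G v = 2 \<and>
       (\<exists>b. branch_vertex G b \<and> card {e \<in> edges G. ends G e = Upair v b} = 2))"

definition admissible_mod_charm_earrings :: "('v, 'e) wgraph \<Rightarrow> bool" where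
  "admissible_mod_charm_earrings G \<longleftrightarrow>
     minimal G \<and> (\<forall>S\<in>segments G. \<not> admissible_segment S \<longrightarrow> charm_earring G S)"

end

theory Submission
  imports Defs
begin

text \<open>
  Call a graph rigid if every at most linear vertex of nonnegative weight has weight 0 and is joined
  to each vertex by an even number of edges (so it is isolated or has both edges at the same
  neighbour), and every vertex of degree 2 with a loop has weight at most 4. Rigidity survives
  blowups. If the minimal graph \<open>\<Gamma>\<close> is rigid, then the graphs obtained from \<open>\<Gamma>\<close> by blowups alone
  are closed under blowdowns: two blowdowns at non-adjacent vertices commute, while at adjacent
  vertices rigidity provides a symmetry exchanging them. Hence every minimal graph in the class is
  \<open>\<Gamma>\<close>. If \<open>\<Gamma>\<close> is not rigid, a few blowups create a 0-vertex joined to some vertex \<open>a\<close> by a single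
  edge. Elementary transformations at this 0-vertex raise the weight of \<open>a\<close> indefinitely, and
  contracting to a minimal graph never lowers a weight, so infinitely many minimal graphs occur.
  A minimal connected graph is rigid iff it is admissible modulo charm earrings or one of
  the listed exceptions.
\<close>

subsection \<open>Edge multiplicities and isomorphism\<close>

text \<open>The vertices that \<open>rigid\<close> tolerates are those where the elementary
  transformation degenerates: blowing up at an isolated 0-vertex, or one of two parallel edges at a
  0-vertex, and then contracting the old vertex gives back a graph isomorphic to the original. The
  condition speaks only of nonnegative weights and loops, not of (-1)-vertices, because blowups
  destroy minimality. Blowups name their new vertices and edges, which makes comparing two blowdowns
  awkward. Everything is therefore phrased through edge multiplicities up to isomorphism. The
  relation \<open>contracts\<close> treats outer blowups, inner blowups and blowups of loops
  uniformly; \<open>blowup_contracts\<close> and \<open>contracts_birational\<close> translate to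
  and from the given moves. Connectedness matters when contracting to a minimal graph: an isolated
  (-1)-vertex violates minimality but cannot be blown down.\<close>

definition rational_graph :: "('v, 'e) wgraph \<Rightarrow> bool" where
  "rational_graph G \<longleftrightarrow> weighted_graph G \<and> rational G = verts G"

definition mult :: "('v, 'e) wgraph \<Rightarrow> 'v \<Rightarrow> 'v \<Rightarrow> nat" where
  "mult G x y = card {e \<in> edges G. ends G e = Upair x y}"

text \<open>A loop counts once here but twice in \<open>degree\<close>; the difference is
  \<open>mult G x x\<close>. Counting it once makes this a plain row sum of the multiplicity
  matrix.\<close>

definition valency :: "('v, 'e) wgraph \<Rightarrow> 'v \<Rightarrow> nat" where
  "valency G x = (\<Sum>y\<in>verts G. mult G x y)"

text \<open>Parallel edges are interchangeable, so between graphs with all vertices rational an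
  isomorphism amounts to a vertex bijection preserving weights and multiplicities; no edge map has
  to be carried along.\<close>

definition iso_by :: "('v \<Rightarrow> 'w) \<Rightarrow> ('v, 'e) wgraph \<Rightarrow> ('w, 'f) wgraph \<Rightarrow> bool" where
  "iso_by f G H \<longleftrightarrow> bij_betw f (verts G) (verts H) \<and>
     (\<forall>x\<in>verts G. weight H (f x) = weight G x) \<and>
     (\<forall>x\<in>verts G. \<forall>y\<in>verts G. mult H (f x) (f y) = mult G x y)"

lemma rational_graphD:
  assumes "rational_graph G"
  shows "finite (verts G)" "verts G \<noteq> {}" "finite (edges G)"
    "\<And>e x y. \<lbrakk>e \<in> edges G; ends G e = Upair x y\<rbrakk> \<Longrightarrow> x \<in> verts G \<and> y \<in> verts G"
    "rational G = verts G"
proof -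
  show "x \<in> verts G \<and> y \<in> verts G" if "e \<in> edges G" "ends G e = Upair x y" for e x y
    using assms that unfolding rational_graph_def weighted_graph_def
    by (metis insert_subset set_uprod_simps)
qed (use assms in \<open>auto simp: rational_graph_def weighted_graph_def\<close>)

lemma mult_commute: "mult G x y = mult G y x"
  unfolding mult_def by (metis Upair_inject)

lemma mult_pos_iff:
  assumes "rational_graph G"
  shows "0 < mult G x y \<longleftrightarrow> (\<exists>e\<in>edges G. ends G e = Upair x y)"
  using rational_graphD(3)[OF assms] by (auto simp: mult_def card_gt_0_iff)

lemma mult_outside:
  assumes "rational_graph G" "x \<notin> verts G"
  shows "mult G x y = 0"
  using mult_pos_iff[OF assms(1), of x y] rational_graphD(4)[OF assms(1)] assms(2) by auto

lemma degree_eq: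
  assumes "rational_graph G"
  shows "degree G x = valency G x + mult G x x"
proof -
  have "{e \<in> edges G. x \<in> set_uprod (ends G e)} =
      (\<Union>y\<in>verts G. {e \<in> edges G. ends G e = Upair x y})"
  proof (intro equalityI subsetI)
    fix e assume e: "e \<in> {e \<in> edges G. x \<in> set_uprod (ends G e)}"
    obtain a b where ab: "ends G e = Upair a b" by (cases "ends G e")
    then have "a \<in> verts G" "b \<in> verts G" "x = a \<or> x = b"
      using rational_graphD(4)[OF assms] e by auto
    then show "e \<in> (\<Union>y\<in>verts G. {e \<in> edges G. ends G e = Upair x y})"
      using e ab by auto
  qed auto
  moreover have "card (\<Union>y\<in>verts G. {e \<in> edges G. ends G e = Upair x y}) = valency G x"
    unfolding valency_def mult_def using rational_graphD(1,3)[OF assms]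
    by (subst card_UN_disjoint) auto
  ultimately show ?thesis
    by (simp add: degree_def loops_at_def mult_def)
qed

lemma loops_at_empty_iff:
  assumes "rational_graph G"
  shows "loops_at G x = {} \<longleftrightarrow> mult G x x = 0"
  using rational_graphD(3)[OF assms] by (auto simp: loops_at_def mult_def)

lemma at_most_linear_iff:
  assumes "rational_graph G"
  shows "at_most_linear G x \<longleftrightarrow> x \<in> verts G \<and> mult G x x = 0 \<and> valency G x \<le> 2"
  using rational_graphD(5)[OF assms] degree_eq[OF assms, of x] loops_at_empty_iff[OF assms, of x]
  by (auto simp: at_most_linear_def)

lemma minimal_iff:
  assumes "rational_graph G"
  shows "minimal G \<longleftrightarrow>
    (\<forall>x\<in>verts G. mult G x x = 0 \<longrightarrow> valency G x \<le> 2 \<longrightarrow> weight G x \<noteq> -1)"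
  using at_most_linear_iff[OF assms] by (auto simp: minimal_def)

lemma mult_le_valency:
  assumes "rational_graph G" "y \<in> verts G"
  shows "mult G x y \<le> valency G x"
  unfolding valency_def using rational_graphD(1)[OF assms(1)] assms(2)
  by (intro member_le_sum) auto

lemma mult_sum_le_valency:
  assumes "rational_graph G" "A \<subseteq> verts G"
  shows "sum (mult G x) A \<le> valency G x"
  unfolding valency_def using rational_graphD(1)[OF assms(1)] assms(2)
  by (intro sum_mono2) auto

lemma isomorphic_imp_iso_by:
  assumes G: "rational_graph G" and H: "weighted_graph H" and "G \<cong> H"
  shows "rational_graph H" "\<exists>f. iso_by f G H"
proof -
  obtain f g where f: "bij_betw f (verts G) (verts H)" and g: "bij_betw g (edges G) (edges H)"
    and fg: "\<And>e. e \<in> edges G \<Longrightarrow> ends H (g e) = map_uprod f (ends G e)"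
    and w: "\<And>v. v \<in> verts G \<Longrightarrow> weight H (f v) = weight G v \<and> (f v \<in> rational H \<longleftrightarrow> v \<in> rational G)"
    using \<open>G \<cong> H\<close> unfolding isomorphic_def by blast
  have "f ` verts G \<subseteq> rational H"
    using w unfolding rational_graphD(5)[OF G] by blast
  then have "verts H \<subseteq> rational H"
    using f by (simp add: bij_betw_imp_surj_on)
  then show "rational_graph H"
    using H by (auto simp: rational_graph_def weighted_graph_def)
  have inj: "inj_on f (verts G)" using f by (rule bij_betw_imp_inj_on)
  have "mult H (f x) (f y) = mult G x y" if xy: "x \<in> verts G" "y \<in> verts G" for x y
  proof -
    have ends: "ends H (g e) = Upair (f x) (f y) \<longleftrightarrow> ends G e = Upair x y" if e: "e \<in> edges G" for e
    proof -
      obtain a b where ab: "ends G e = Upair a b" by (cases "ends G e")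
      then show ?thesis
        using fg[OF e] rational_graphD(4)[OF G e ab] xy inj by (auto simp: inj_on_eq_iff)
    qed
    have "g ` {e \<in> edges G. ends G e = Upair x y} = {e \<in> edges H. ends H e = Upair (f x) (f y)}"
    proof (intro equalityI subsetI)
      fix e' assume e': "e' \<in> {e \<in> edges H. ends H e = Upair (f x) (f y)}"
      then have "e' \<in> g ` edges G" using bij_betw_imp_surj_on[OF g] by simp
      then obtain e where "e \<in> edges G" "g e = e'" by blast
      then show "e' \<in> g ` {e \<in> edges G. ends G e = Upair x y}"
        using ends[of e] e' by (intro image_eqI[of _ _ e]) auto
    next
      fix e' assume "e' \<in> g ` {e \<in> edges G. ends G e = Upair x y}"
      then obtain e where "e \<in> edges G" "ends G e = Upair x y" "e' = g e" by blast
      then show "e' \<in> {e \<in> edges H. ends H e = Upair (f x) (f y)}"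
        using ends[of e] bij_betwE[OF g] by simp
    qed
    moreover have "inj_on g {e \<in> edges G. ends G e = Upair x y}"
      using bij_betw_imp_inj_on[OF g] by (rule inj_on_subset) auto
    ultimately show ?thesis
      using card_image[of g "{e \<in> edges G. ends G e = Upair x y}"] by (simp add: mult_def)
  qed
  with f w have "iso_by f G H" by (simp add: iso_by_def)
  then show "\<exists>f. iso_by f G H" by (rule exI[of "\<lambda>f. iso_by f G H" f])
qed

lemma iso_by_imp_isomorphic:
  assumes G: "rational_graph G" and H: "rational_graph H" and iso: "iso_by f G H"
  shows "G \<cong> H"
proof -
  define FG where "FG p = {e \<in> edges G. ends G e = p}" for p
  define FH where "FH p = {e \<in> edges H. ends H e = p}" for p
  have f: "bij_betw f (verts G) (verts H)" and inj: "inj_on f (verts G)"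
    using iso by (auto simp: iso_by_def bij_betw_def)
  \<comment> \<open>Edges are grouped by their endpoints. Equal multiplicities give a bijection for
    each group, and \<open>g\<close> below glues these together.\<close>
  have "\<exists>h. bij_betw h (FG p) (FH (map_uprod f p))" if "set_uprod p \<subseteq> verts G" for p
  proof -
    obtain a b where p: "p = Upair a b" by (cases p)
    then have "card (FG p) = card (FH (map_uprod f p))"
      using that iso by (simp add: iso_by_def mult_def FG_def FH_def)
    then show ?thesis
      using rational_graphD(3)[OF G] rational_graphD(3)[OF H]
      by (intro finite_same_card_bij) (auto simp: FG_def FH_def)
  qed
  then obtain h where h: "\<And>p. set_uprod p \<subseteq> verts G \<Longrightarrow> bij_betw (h p) (FG p) (FH (map_uprod f p))"
    by metis
  define g where "g e = h (ends G e) e" for e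
  have sub: "set_uprod (ends G e) \<subseteq> verts G" if "e \<in> edges G" for e
    using G that unfolding rational_graph_def weighted_graph_def by blast
  have gH: "g e \<in> edges H \<and> ends H (g e) = map_uprod f (ends G e)" if "e \<in> edges G" for e
  proof -
    have "e \<in> FG (ends G e)" using that by (simp add: FG_def)
    then have "h (ends G e) e \<in> FH (map_uprod f (ends G e))"
      using bij_betwE[OF h[OF sub[OF that]]] by blast
    then show ?thesis by (simp add: g_def FH_def)
  qed
  have map_inj: "p = q" if "map_uprod f p = map_uprod f q" "set_uprod p \<subseteq> verts G" "set_uprod q \<subseteq> verts G" for p q
    using that inj by (cases p; cases q) (auto simp: inj_on_eq_iff)
  have "inj_on g (edges G)"
  proof (rule inj_onI)
    fix e e' assume e: "e \<in> edges G" "e' \<in> edges G" "g e = g e'"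
    then have eq: "ends G e = ends G e'" using gH sub by (intro map_inj) metis+
    have "inj_on (h (ends G e)) (FG (ends G e))" using h[OF sub[OF e(1)]] by (rule bij_betw_imp_inj_on)
    then show "e = e'" using e eq by (auto simp: g_def FG_def inj_on_def)
  qed
  moreover have "edges H \<subseteq> g ` edges G"
  proof
    fix e' assume e': "e' \<in> edges H"
    obtain c d where cd: "ends H e' = Upair c d" by (cases "ends H e'")
    then have "c \<in> f ` verts G" "d \<in> f ` verts G"
      using rational_graphD(4)[OF H e' cd] f by (auto simp: bij_betw_def)
    then obtain a b where ab: "a \<in> verts G" "b \<in> verts G" "c = f a" "d = f b" by blast
    then have "e' \<in> FH (map_uprod f (Upair a b))" using cd e' by (simp add: FH_def)
    then have "e' \<in> h (Upair a b) ` FG (Upair a b)"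
      using bij_betw_imp_surj_on[OF h[of "Upair a b"]] ab by simp
    then obtain e where "e \<in> FG (Upair a b)" "h (Upair a b) e = e'" by blast
    then show "e' \<in> g ` edges G" by (auto simp: FG_def g_def intro!: image_eqI)
  qed
  ultimately have "bij_betw g (edges G) (edges H)" using gH by (auto simp: bij_betw_def)
  moreover have "\<forall>v\<in>verts G. weight H (f v) = weight G v \<and> (f v \<in> rational H \<longleftrightarrow> v \<in> rational G)"
    using iso f rational_graphD(5)[OF G] rational_graphD(5)[OF H]
    by (auto simp: iso_by_def bij_betw_def)
  ultimately show ?thesis unfolding isomorphic_def using f gH by blast
qed

lemma isomorphic_iff:
  assumes "rational_graph G" "rational_graph H"
  shows "G \<cong> H \<longleftrightarrow> (\<exists>f. iso_by f G H)"
  using assms isomorphic_imp_iso_by iso_by_imp_isomorphic by (metis rational_graph_def)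

lemma iso_by_inv:
  assumes "iso_by f G H"
  shows "iso_by (inv_into (verts G) f) H G"
proof -
  let ?g = "inv_into (verts G) f"
  have f: "bij_betw f (verts G) (verts H)" using assms by (simp add: iso_by_def)
  then have g: "bij_betw ?g (verts H) (verts G)" by (rule bij_betw_inv_into)
  have "?g x \<in> verts G" "f (?g x) = x" if "x \<in> verts H" for x
    using that f g by (auto simp: bij_betw_inv_into_right bij_betwE)
  then show ?thesis using g assms unfolding iso_by_def by metis
qed

lemma iso_by_comp:
  assumes "iso_by f G H" "iso_by g H K"
  shows "iso_by (g \<circ> f) G K"
  using assms bij_betwE[of f "verts G" "verts H"] by (auto simp: iso_by_def intro: bij_betw_trans)

lemma isomorphic_sym:
  assumes "rational_graph G" "rational_graph H" "G \<cong> H"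
  shows "H \<cong> G"
  using assms isomorphic_iff iso_by_inv by metis

lemma isomorphic_trans:
  assumes "rational_graph G" "rational_graph H" "rational_graph K" "G \<cong> H" "H \<cong> K"
  shows "G \<cong> K"
  using assms isomorphic_iff iso_by_comp by metis

lemma iso_by_valency:
  assumes "iso_by f G H" "x \<in> verts G"
  shows "valency H (f x) = valency G x"
proof -
  have f: "bij_betw f (verts G) (verts H)" using assms by (simp add: iso_by_def)
  have "valency H (f x) = (\<Sum>y\<in>verts G. mult H (f x) (f y))"
    unfolding valency_def using sum.reindex_bij_betw[OF f] by metis
  also have "\<dots> = valency G x"
    unfolding valency_def using assms by (intro sum.cong) (auto simp: iso_by_def)
  finally show ?thesis .
qed

text \<open>Edges are pairs of an unordered pair of endpoints and an index, embedded into the infinite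
  edge type.\<close>

lemma graph_with_mult:
  fixes V :: "'v set" and m :: "'v \<Rightarrow> 'v \<Rightarrow> nat" and w :: "'v \<Rightarrow> int"
  assumes "finite V" "V \<noteq> {}" and sym: "\<And>x y. m x y = m y x"
  obtains G :: "('v, 'e::infinite) wgraph"
  where "rational_graph G" "verts G = V" "weight G = w"
    "\<And>x y. \<lbrakk>x \<in> V; y \<in> V\<rbrakk> \<Longrightarrow> mult G x y = m x y"
proof -
  \<comment> \<open>The symmetry of \<open>m\<close> makes this well defined on unordered
    pairs.\<close>
  define n where "n p = (THE k. \<forall>x y. p = Upair x y \<longrightarrow> k = m x y)" for p
  have n: "n (Upair x y) = m x y" for x y
    unfolding n_def by (rule the_equality) (use sym in auto)
  define P where "P = (\<lambda>(x, y). Upair x y) ` (V \<times> V)"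
  define T where "T = (SIGMA p:P. {..<n p})"
  have "finite T" using assms by (auto simp: T_def P_def)
  then obtain h :: "'v uprod \<times> nat \<Rightarrow> 'e" where h: "inj_on h T"
    using arb_inj_on_finite_infinite by blast
  define G where "G = \<lparr>verts = V, edges = h ` T, ends = (\<lambda>e. fst (inv_into T h e)),
    weight = w, rational = V\<rparr>"
  have "rational_graph G"
    using assms h \<open>finite T\<close>
    by (auto simp: rational_graph_def weighted_graph_def G_def T_def P_def)
  moreover have "mult G x y = m x y" if "x \<in> V" "y \<in> V" for x y
  proof -
    have "{e \<in> edges G. ends G e = Upair x y} = h ` {t \<in> T. fst t = Upair x y}"
      using inv_into_f_f[OF h] by (auto simp: G_def)
    also have "{t \<in> T. fst t = Upair x y} = {Upair x y} \<times> {..<m x y}"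
    proof -
      have "Upair x y \<in> P" using that by (force simp: P_def)
      then have "{t \<in> T. fst t = p} = {p} \<times> {..<n p}" if "p = Upair x y" for p
        using that by (auto simp: T_def)
      then show ?thesis using n by simp
    qed
    finally have "{e \<in> edges G. ends G e = Upair x y} = h ` ({Upair x y} \<times> {..<m x y})" .
    moreover have "inj_on h ({Upair x y} \<times> {..<m x y})"
      by (rule inj_on_subset[OF h]) (use that in \<open>force simp: T_def P_def n\<close>)
    ultimately show ?thesis by (simp add: mult_def card_image)
  qed
  ultimately show ?thesis using that[of G] by (auto simp: G_def)
qed

subsection \<open>Contraction of a vertex\<close>

text \<open>Blowing down both kinds of (-1)-vertices is a single operation on multiplicities, as for
  intersection numbers of curves: if \<open>c x\<close> edges join the contracted vertex to \<open>x\<close>, the weight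
  of \<open>x\<close> grows by \<open>c x\<^sup>2\<close>, and there are \<open>c x * c y\<close> new edges between \<open>x\<close> and
  \<open>y\<close> and \<open>c x choose 2\<close> new loops at \<open>x\<close>.\<close>

definition contracts :: "('v, 'e) wgraph \<Rightarrow> 'v \<Rightarrow> ('v, 'e) wgraph \<Rightarrow> bool" where
  "contracts H v G \<longleftrightarrow> rational_graph H \<and> rational_graph G \<and>
     v \<in> verts H \<and> weight H v = -1 \<and> mult H v v = 0 \<and> (valency H v = 1 \<or> valency H v = 2) \<and>
     verts G = verts H - {v} \<and>
     (\<forall>x\<in>verts G. weight G x = weight H x + int (mult H v x) ^ 2) \<and>
     (\<forall>x\<in>verts G. \<forall>y\<in>verts G. mult G x y = mult H x y +
        (if x = y then mult H v x choose 2 else mult H v x * mult H v y))"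

lemma contractsD:
  assumes "contracts H v G"
  shows "rational_graph H" "rational_graph G" "v \<in> verts H" "v \<notin> verts G" "weight H v = -1"
    "mult H v v = 0" "valency H v = 1 \<or> valency H v = 2" "verts H = insert v (verts G)"
    "\<And>x. x \<in> verts G \<Longrightarrow> weight G x = weight H x + int (mult H v x) ^ 2"
    "\<And>x y. \<lbrakk>x \<in> verts G; y \<in> verts G; x \<noteq> y\<rbrakk> \<Longrightarrow>
      mult G x y = mult H x y + mult H v x * mult H v y"
    "\<And>x. x \<in> verts G \<Longrightarrow> mult G x x = mult H x x + (mult H v x choose 2)"
  using assms unfolding contracts_def by auto

lemma contracts_mult_le:
  assumes "contracts H v G"
  shows "mult H v x \<le> 2"
proof (cases "x \<in> verts H")
  case True
  then show ?thesis
    using mult_le_valency[OF contractsD(1)[OF assms] True, of v] contractsD(7)[OF assms] by linarith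
next
  case False
  then show ?thesis
    using mult_outside[OF contractsD(1)[OF assms] False, of v] by (simp add: mult_commute)
qed

text \<open>With \<open>c = mult H v x\<close>, the contraction creates
  \<open>c * (valency H v - c)\<close> edges from \<open>x\<close> to other vertices. In the third
  clause the square of \<open>c\<close> stands on the left so that no subtraction of naturals
  occurs.\<close>

lemma contracts_valency:
  assumes "contracts H v G"
  shows "valency H v = (\<Sum>x\<in>verts G. mult H v x)"
    "x \<in> verts G \<Longrightarrow> valency H x = (\<Sum>y\<in>verts G. mult H x y) + mult H v x"
    "x \<in> verts G \<Longrightarrow> valency G x + mult H v x ^ 2 =
      (\<Sum>y\<in>verts G. mult H x y) + (mult H v x choose 2) + mult H v x * valency H v"
proof -
  note C = contractsD[OF assms]
  have fin: "finite (verts G)" using C(2) by (rule rational_graphD)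
  show val: "valency H v = (\<Sum>x\<in>verts G. mult H v x)"
    unfolding valency_def C(8) using C(4,6) fin by simp
  show "valency H x = (\<Sum>y\<in>verts G. mult H x y) + mult H v x" if "x \<in> verts G"
    unfolding valency_def C(8) using C(4) fin mult_commute[of H x v] by simp
  show "valency G x + mult H v x ^ 2 =
      (\<Sum>y\<in>verts G. mult H x y) + (mult H v x choose 2) + mult H v x * valency H v"
    if x: "x \<in> verts G"
  proof -
    have "valency G x = mult G x x + (\<Sum>y\<in>verts G - {x}. mult G x y)"
      unfolding valency_def using fin x by (rule sum.remove)
    also have "(\<Sum>y\<in>verts G - {x}. mult G x y) =
        (\<Sum>y\<in>verts G - {x}. mult H x y + mult H v x * mult H v y)"
      using C(10) x by (intro sum.cong) auto
    finally have "valency G x = mult H x x + (mult H v x choose 2) +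
        ((\<Sum>y\<in>verts G - {x}. mult H x y) + mult H v x * (\<Sum>y\<in>verts G - {x}. mult H v y))"
      using C(11)[OF x] by (simp add: sum.distrib sum_distrib_left)
    moreover have "(\<Sum>y\<in>verts G. mult H x y) = mult H x x + (\<Sum>y\<in>verts G - {x}. mult H x y)"
      using fin x by (rule sum.remove)
    moreover have "valency H v = mult H v x + (\<Sum>y\<in>verts G - {x}. mult H v y)"
      unfolding val using fin x by (rule sum.remove)
    ultimately show ?thesis by (simp add: power2_eq_square algebra_simps)
  qed
qed

lemma contracts_valency_0:
  assumes "contracts H v G" "x \<in> verts G" "mult H v x = 0"
  shows "valency G x = valency H x"
  using contracts_valency(2,3)[OF assms(1,2)] assms(3) by simp

lemma contracts_valency_1:
  assumes "contracts H v G" "x \<in> verts G" "mult H v x = 1"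
  shows "valency G x + 2 = valency H x + valency H v"
  using contracts_valency(2,3)[OF assms(1,2)] assms(3) by simp

text \<open>The two edges from \<open>x\<close> to \<open>v\<close> merge into one loop, which
  \<open>valency\<close> counts once.\<close>

lemma contracts_valency_2:
  assumes "contracts H v G" "x \<in> verts G" "mult H v x = 2"
  shows "valency G x + 1 = valency H x"
proof -
  have "valency H v = 2"
    using contractsD(7)[OF assms(1)] mult_le_valency[of H x v] contractsD(1,8)[OF assms(1)] assms(2,3)
    by auto
  then show ?thesis
    using contracts_valency(2,3)[OF assms(1,2)] assms(3) by simp
qed

text \<open>A contraction is determined by the weights and multiplicities of \<open>H\<close> and by
  \<open>v\<close>, so the isomorphism restricts. Applied to an automorphism of \<open>H\<close>,
  this compares the contractions of two different vertices of the same graph.\<close>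

lemma contracts_cong:
  assumes "contracts H v G" "contracts H' v' G'" "iso_by f H H'" "f v = v'"
  shows "iso_by f G G'"
proof -
  note C = contractsD[OF assms(1)] and C' = contractsD[OF assms(2)]
  have f: "bij_betw f (verts H) (verts H')"
    and w: "\<And>x. x \<in> verts H \<Longrightarrow> weight H' (f x) = weight H x"
    and m: "\<And>x y. x \<in> verts H \<Longrightarrow> y \<in> verts H \<Longrightarrow> mult H' (f x) (f y) = mult H x y"
    using assms(3) by (auto simp: iso_by_def)
  have inj: "inj_on f (verts H)" using f by (rule bij_betw_imp_inj_on)
  have "f ` verts G = f ` verts H - {f v}"
    using inj_on_image_set_diff[OF inj, of "verts H" "{v}"] C(3,4,8) by auto
  then have img: "f ` verts G = verts G'"
    using C'(4,8) assms(4) bij_betw_imp_surj_on[OF f] by auto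
  have inj': "inj_on f (verts G)" using inj by (rule inj_on_subset) (use C(8) in auto)
  have mv: "mult H' v' (f x) = mult H v x" if "x \<in> verts G" for x
    using m[of v x] that C(3,8) assms(4) by simp
  have in_G': "f x \<in> verts G'" if "x \<in> verts G" for x using img that by auto
  have "weight G' (f x) = weight G x" if "x \<in> verts G" for x
    using C(9)[OF that] C'(9)[OF in_G'[OF that]] mv[OF that] w[of x] that C(8) by simp
  moreover have "mult G' (f x) (f y) = mult G x y" if "x \<in> verts G" "y \<in> verts G" for x y
  proof (cases "x = y")
    case True
    then show ?thesis
      using C(11)[OF that(1)] C'(11)[OF in_G'[OF that(1)]] mv[OF that(1)] m[of x x] that C(8) by simp
  next
    case False
    then have "f x \<noteq> f y" using inj' that by (auto simp: inj_on_eq_iff)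
    then show ?thesis
      using C(10)[OF that False] C'(10)[OF in_G'[OF that(1)] in_G'[OF that(2)]] mv[OF that(1)]
        mv[OF that(2)] m[of x y] that C(8) by simp
  qed
  ultimately show ?thesis using inj' img by (auto simp: iso_by_def bij_betw_def)
qed

lemma contracts_unique:
  assumes "contracts H v G" "contracts H v G'"
  shows "G \<cong> G'"
proof -
  have "iso_by id H H" by (simp add: iso_by_def)
  then have "iso_by id G G'" using contracts_cong[OF assms] by simp
  then show ?thesis using iso_by_imp_isomorphic contractsD(2) assms by metis
qed

text \<open>The contraction formulas can be solved for \<open>H\<close>: the graph \<open>G\<close>
  together with the multiplicities at the contracted vertex recovers all weights and edges. This is
  how an abstract contraction is matched with an actual blowup.\<close>

lemma blowups_isomorphic:
  assumes "contracts H v G" "contracts H' v' G"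
    and "\<And>x. x \<in> verts G \<Longrightarrow> mult H v x = mult H' v' x"
  shows "H \<cong> H'"
proof -
  note C = contractsD[OF assms(1)] and C' = contractsD[OF assms(2)]
  define f where "f x = (if x = v then v' else x)" for x
  have "bij_betw f (verts H) (verts H')"
    unfolding bij_betw_def inj_on_def C(8) C'(8) using C(4) C'(4) by (auto simp: f_def)
  moreover have "weight H' (f x) = weight H x" if "x \<in> verts H" for x
    using that C(4,5,8) C'(5) C(9)[of x] C'(9)[of x] assms(3)[of x] by (auto simp: f_def)
  moreover have "mult H' (f x) (f y) = mult H x y" if "x \<in> verts H" "y \<in> verts H" for x y
  proof -
    have "mult H' x y = mult H x y" if "x \<in> verts G" "y \<in> verts G"
      using that C(10,11)[of x] C'(10,11)[of x] assms(3) by (cases "x = y") fastforce+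
    then show ?thesis
      using that C(4,6,8) C'(6) assms(3)[of x] assms(3)[of y] mult_commute[of H x v] mult_commute[of H' x v']
      by (auto simp: f_def)
  qed
  ultimately have "iso_by f H H'" by (auto simp: iso_by_def)
  then show ?thesis using C(1) C'(1) by (intro iso_by_imp_isomorphic)
qed

lemma contraction_exists:
  fixes H :: "('v, 'e::infinite) wgraph"
  assumes H: "rational_graph H" and v: "v \<in> verts H" "weight H v = -1" "mult H v v = 0"
    "valency H v = 1 \<or> valency H v = 2"
  obtains G where "contracts H v G"
proof -
  define m where "m x y = mult H x y +
    (if x = y then mult H v x choose 2 else mult H v x * mult H v y)" for x y
  \<comment> \<open>Weighted graphs are nonempty; a loop-free vertex of positive valency has a
    neighbour that survives.\<close>
  have "verts H - {v} \<noteq> {}"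
  proof
    assume "verts H - {v} = {}"
    then have "verts H = {v}" using v by auto
    then show False using v by (simp add: valency_def)
  qed
  moreover have "m x y = m y x" for x y by (simp add: m_def mult_commute)
  ultimately obtain G :: "('v, 'e) wgraph" where "rational_graph G" "verts G = verts H - {v}"
    "weight G = (\<lambda>x. weight H x + int (mult H v x) ^ 2)"
    "\<And>x y. \<lbrakk>x \<in> verts H - {v}; y \<in> verts H - {v}\<rbrakk> \<Longrightarrow> mult G x y = m x y"
    using graph_with_mult[of "verts H - {v}" m "\<lambda>x. weight H x + int (mult H v x) ^ 2"]
      rational_graphD(1)[OF H] by auto
  then have "contracts H v G" using H v by (simp add: contracts_def m_def)
  then show ?thesis by (rule that)
qed

section \<open>Blowups as inverses of contractions\<close>

lemma outer_blowup_contracts: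
  assumes G: "rational_graph G" and "a \<in> verts G" "v \<notin> verts G" "e \<notin> edges G"
    and H: "H = \<lparr> verts = insert v (verts G), edges = insert e (edges G),
      ends = (ends G)(e := Upair a v), weight = (weight G)(a := weight G a - 1, v := -1),
      rational = insert v (rational G) \<rparr>"
  shows "contracts H v G" "\<And>x. x \<in> verts G \<Longrightarrow> mult H v x = of_bool (x = a)"
proof -
  note D = rational_graphD[OF G]
  have rg: "rational_graph H"
    using G assms(2-4) by (auto simp: H rational_graph_def weighted_graph_def)
  have old: "mult H x y = mult G x y" if "x \<in> verts G" "y \<in> verts G" for x y
  proof -
    have "{e' \<in> edges H. ends H e' = Upair x y} = {e' \<in> edges G. ends G e' = Upair x y}"
      using that assms(3,4) by (auto simp: H)
    then show ?thesis by (simp add: mult_def)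
  qed
  have new_edges: "{e' \<in> edges H. ends H e' = Upair v x} = (if x = a then {e} else {})" for x
    using assms(2-4) D(4) by (auto simp: H)
  then show new: "mult H v x = of_bool (x = a)" if "x \<in> verts G" for x
    by (simp add: mult_def)
  have "mult H v v = 0" using new_edges[of v] assms(2,3) by (auto simp: mult_def)
  moreover from this have "valency H v = 1"
    using new D(1) assms(2,3) by (simp add: valency_def H)
  moreover have "weight G x = weight H x + int (mult H v x) ^ 2" if "x \<in> verts G" for x
    using that new assms(3) by (auto simp: H)
  moreover have "mult G x y = mult H x y +
      (if x = y then mult H v x choose 2 else mult H v x * mult H v y)"
    if "x \<in> verts G" "y \<in> verts G" for x y
    using that old new by auto
  ultimately show "contracts H v G"
    using rg G assms(3) unfolding contracts_def by (simp add: H)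
qed

text \<open>The loop case \<open>a = b\<close> fits the same formulas: two edges join the new vertex
  to \<open>a\<close>, their square is the 4 by which the weight drops, and 2 choose 2 = 1 restores
  the loop.\<close>

lemma inner_blowup_contracts:
  assumes G: "rational_graph G" and e: "e \<in> edges G" "ends G e = Upair a b" "v \<notin> verts G"
    "e1 \<notin> edges G" "e2 \<notin> edges G" "e1 \<noteq> e2"
    and H: "H = \<lparr> verts = insert v (verts G), edges = (edges G - {e}) \<union> {e1, e2},
      ends = (ends G)(e1 := Upair a v, e2 := Upair v b),
      weight = (if a \<noteq> b then (weight G)(a := weight G a - 1, b := weight G b - 1, v := -1)
        else (weight G)(a := weight G a - 4, v := -1)),
      rational = insert v (rational G) \<rparr>"
  shows "contracts H v G" "\<And>x. x \<in> verts G \<Longrightarrow> mult H v x = of_bool (x = a) + of_bool (x = b)"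
proof -
  note D = rational_graphD[OF G]
  have ab: "a \<in> verts G" "b \<in> verts G" using D(4)[OF e(1,2)] by auto
  have rg: "rational_graph H"
    using G e ab by (auto simp: H rational_graph_def weighted_graph_def)
  have old: "mult G x y = mult H x y + of_bool (Upair x y = Upair a b)"
    if "x \<in> verts G" "y \<in> verts G" for x y
  proof -
    \<comment> \<open>Both \<open>e1\<close> and \<open>e2\<close> end in the new vertex, so between
      old vertices only \<open>e\<close> disappears.\<close>
    have H_eq: "{e' \<in> edges H. ends H e' = Upair x y} = {e' \<in> edges G. ends G e' = Upair x y} - {e}"
      using that e by (auto simp: H)
    show ?thesis
    proof (cases "Upair x y = Upair a b")
      case True
      then have "e \<in> {e' \<in> edges G. ends G e' = Upair x y}" using e(1,2) by auto
      then have "card {e' \<in> edges G. ends G e' = Upair x y} =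
          Suc (card ({e' \<in> edges G. ends G e' = Upair x y} - {e}))"
        using D(3) by (intro card.remove) auto
      moreover have "of_bool (Upair x y = Upair a b) = (1 :: nat)" using True by simp
      ultimately show ?thesis by (simp only: mult_def H_eq Suc_eq_plus1)
    next
      case False
      then have "{e' \<in> edges G. ends G e' = Upair x y} - {e} = {e' \<in> edges G. ends G e' = Upair x y}"
        using e by auto
      then show ?thesis using False unfolding mult_def H_eq by simp
    qed
  qed
  have "{e' \<in> edges H. ends H e' = Upair v x} =
      (if x = a then {e1} else {}) \<union> (if x = b then {e2} else {})" for x
    using e ab D(4) by (auto simp: H)
  then have new: "mult H v x = of_bool (x = a) + of_bool (x = b)" for x
    using e(6) by (simp add: mult_def)
  show "mult H v x = of_bool (x = a) + of_bool (x = b)" for x by (rule new)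
  have "mult H v v = 0" using new[of v] ab e(3) by auto
  moreover from this have "valency H v = 2"
    using D(1) ab e(3) by (simp add: valency_def H[THEN arg_cong[where f=verts]] new sum.distrib)
  moreover have "weight G x = weight H x + int (mult H v x) ^ 2" if "x \<in> verts G" for x
    using that new e(3) by (auto simp: H)
  moreover have "mult G x y = mult H x y +
      (if x = y then mult H v x choose 2 else mult H v x * mult H v y)"
    if "x \<in> verts G" "y \<in> verts G" for x y
    unfolding old[OF that] new by (auto simp: numeral_2_eq_2)
  moreover have "verts H = insert v (verts G)" "weight H v = -1" by (simp_all add: H)
  ultimately show "contracts H v G"
    using rg G e(3) unfolding contracts_def by simp
qed

lemma blowup_contracts:
  assumes "rational_graph G" "blowup G H"
  shows "\<exists>v. contracts H v G"
  using assms(2) unfolding blowup_def inner_blowup_def outer_blowup_def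
  using inner_blowup_contracts(1)[OF assms(1)] outer_blowup_contracts(1)[OF assms(1)]
  by (elim disjE exE conjE) metis+

lemma outer_blowup_exists:
  fixes G :: "('v::infinite, 'e::infinite) wgraph"
  assumes G: "rational_graph G" and "a \<in> verts G"
  obtains H v where "blowup G H" "contracts H v G"
    "\<And>x. x \<in> verts G \<Longrightarrow> mult H v x = of_bool (x = a)"
proof -
  obtain v e where v: "v \<notin> verts G" "e \<notin> edges G"
    using arb_element rational_graphD(1,3)[OF G] by metis
  define H where "H = \<lparr> verts = insert v (verts G), edges = insert e (edges G),
      ends = (ends G)(e := Upair a v), weight = (weight G)(a := weight G a - 1, v := -1),
      rational = insert v (rational G) \<rparr>"
  have "outer_blowup G H" unfolding outer_blowup_def using assms(2) v H_def by blast
  then show ?thesis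
    using that[of H v] outer_blowup_contracts[OF assms v H_def] by (simp add: blowup_def)
qed

lemma inner_blowup_exists:
  fixes G :: "('v::infinite, 'e::infinite) wgraph"
  assumes G: "rational_graph G" and "0 < mult G a b"
  obtains H v where "blowup G H" "contracts H v G"
    "\<And>x. x \<in> verts G \<Longrightarrow> mult H v x = of_bool (x = a) + of_bool (x = b)"
proof -
  obtain e where e: "e \<in> edges G" "ends G e = Upair a b"
    using mult_pos_iff[OF G] assms(2) by blast
  obtain v where v: "v \<notin> verts G" using arb_element rational_graphD(1)[OF G] by metis
  obtain e1 where e1: "e1 \<notin> edges G" using arb_element rational_graphD(3)[OF G] by metis
  obtain e2 where e2: "e2 \<notin> insert e1 (edges G)"
    using arb_element rational_graphD(3)[OF G] by (metis finite_insert)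
  define H where "H = \<lparr> verts = insert v (verts G), edges = (edges G - {e}) \<union> {e1, e2},
      ends = (ends G)(e1 := Upair a v, e2 := Upair v b),
      weight = (if a \<noteq> b then (weight G)(a := weight G a - 1, b := weight G b - 1, v := -1)
        else (weight G)(a := weight G a - 4, v := -1)),
      rational = insert v (rational G) \<rparr>"
  have e2': "e2 \<notin> edges G" "e1 \<noteq> e2" using e2 by auto
  have "inner_blowup G H" unfolding inner_blowup_def using e v e1 e2' H_def by blast
  then show ?thesis
    using that[of H v] inner_blowup_contracts[OF G e v e1 e2' H_def] by (simp add: blowup_def)
qed

subsection \<open>Rigid graphs\<close>

text \<open>With valency at most 2, evenness means multiplicity 0 or 2. The second clause concerns a
  vertex whose only edge is a loop. Blowing up the loop lowers the weight by 4 and leaves a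
  loop-free vertex with both edges at the new vertex; the bound 4 is what makes the first clause
  hold for it.\<close>

definition rigid :: "('v, 'e) wgraph \<Rightarrow> bool" where
  "rigid G \<longleftrightarrow> (\<forall>x\<in>verts G.
     (mult G x x = 0 \<and> valency G x \<le> 2 \<and> 0 \<le> weight G x \<longrightarrow>
        weight G x = 0 \<and> (\<forall>y\<in>verts G. even (mult G x y))) \<and>
     (mult G x x = 1 \<and> valency G x = 1 \<longrightarrow> weight G x \<le> 4))"

lemma rigidD:
  assumes "rigid G" "x \<in> verts G"
  shows "\<lbrakk>mult G x x = 0; valency G x \<le> 2; 0 \<le> weight G x\<rbrakk> \<Longrightarrow> weight G x = 0"
    "\<lbrakk>mult G x x = 0; valency G x \<le> 2; 0 \<le> weight G x; y \<in> verts G\<rbrakk> \<Longrightarrow> even (mult G x y)"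
    "\<lbrakk>mult G x x = 1; valency G x = 1\<rbrakk> \<Longrightarrow> weight G x \<le> 4"
  using assms unfolding rigid_def by blast+

lemma rigid_iso:
  assumes iso: "iso_by f G H" and H: "rigid H"
  shows "rigid G"
proof -
  have f: "f x \<in> verts H" if "x \<in> verts G" for x
    using iso that by (auto simp: iso_by_def dest: bij_betwE)
  have *: "mult H (f x) (f y) = mult G x y" "weight H (f x) = weight G x"
    "valency H (f x) = valency G x" if "x \<in> verts G" "y \<in> verts G" for x y
    using iso that iso_by_valency[OF iso that(1)] by (auto simp: iso_by_def)
  show ?thesis
    unfolding rigid_def
  proof (intro ballI conjI impI; (elim conjE)?)
    fix x y assume x: "x \<in> verts G" and "mult G x x = 0" "valency G x \<le> 2" "0 \<le> weight G x"
    then show "weight G x = 0" "y \<in> verts G \<Longrightarrow> even (mult G x y)"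
      using rigidD[OF H f[OF x]] *[OF x] f by metis+
  next
    fix x assume x: "x \<in> verts G" and "mult G x x = 1" "valency G x = 1"
    then show "weight G x \<le> 4"
      using rigidD(3)[OF H f[OF x]] *[OF x] by metis
  qed
qed

lemma rigid_blowup:
  assumes HG: "contracts H v G" and G: "rigid G"
  shows "rigid H"
proof -
  note C = contractsD[OF HG]
  have mem: "x \<in> verts G" if "x \<in> verts H" "x \<noteq> v" for x using that C(8) by auto
  have main: "weight H x = 0 \<and> (\<forall>y\<in>verts H. even (mult H x y))"
    if x: "x \<in> verts H" and lin: "mult H x x = 0" "valency H x \<le> 2" "0 \<le> weight H x" for x
  proof -
    have xG: "x \<in> verts G" using mem x lin C(5) by force
    consider "mult H v x = 0" | "mult H v x = 1" | "mult H v x = 2"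
      using contracts_mult_le[OF HG, of x] by linarith
    then show ?thesis
    proof cases
      case 1
      have "mult G x y = mult H x y" if "y \<in> verts G" for y
        using C(10,11) xG that 1 by (cases "x = y") auto
      moreover have "weight G x = weight H x" "valency G x = valency H x" "mult H x v = 0"
        using C(9)[OF xG] contracts_valency_0[OF HG xG 1] 1 by (simp_all add: mult_commute)
      ultimately show ?thesis using rigidD(1,2)[OF G xG] lin xG C(8) by auto
    next
      case 2
      \<comment> \<open>Here \<open>x\<close> would have weight at least 1 in \<open>G\<close> and
        still be at most linear, against the rigidity of \<open>G\<close>; the case is void.\<close>
      have "valency G x \<le> 2" using contracts_valency_1[OF HG xG 2] lin C(7) by auto
      moreover have "mult G x x = 0" "weight G x = weight H x + 1"
        using C(9,11)[OF xG] 2 lin by simp_all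
      ultimately show ?thesis using rigidD(1)[OF G xG] lin by simp
    next
      case 3
      have "valency G x = 1" "mult G x x = 1" "weight G x = weight H x + 4"
        using contracts_valency_2[OF HG xG 3] C(9,11)[OF xG] 3 lin
          mult_le_valency[OF C(1) C(3), of x] by (auto simp: mult_commute)
      \<comment> \<open>In \<open>G\<close> the vertex carried a loop and had weight at least 4,
        hence exactly 4 by rigidity.\<close>
      then have w: "weight H x = 0" using rigidD(3)[OF G xG] lin by simp
      have "mult H x y = 0" if "y \<in> verts H" "y \<noteq> v" for y
        using mult_sum_le_valency[OF C(1), of "{v, y}" x] that C(3) 3 lin
        by (simp add: mult_commute)
      then have "even (mult H x y)" if "y \<in> verts H" for y
        using that 3 mult_commute[of H x v] by (cases "y = v") auto
      then show ?thesis using w by simp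
    qed
  qed
  moreover have "weight H x \<le> 4"
    if x: "x \<in> verts H" and l: "mult H x x = 1" "valency H x = 1" for x
  proof -
    have "x \<noteq> v" using l C(6) by auto
    \<comment> \<open>An edge to \<open>v\<close> besides the loop would raise the valency above 1,
      so the blowup did not touch \<open>x\<close>.\<close>
    then have xG: "x \<in> verts G" and 0: "mult H v x = 0"
      using mem x mult_sum_le_valency[OF C(1), of "{v, x}" x] C(3) l
      by (auto simp: mult_commute[of H v x])
    then show ?thesis
      using rigidD(3)[OF G xG] C(9,11)[OF xG] contracts_valency_0[OF HG xG 0] l by simp
  qed
  ultimately show ?thesis unfolding rigid_def by blast
qed

section \<open>Graphs obtained from a fixed graph by blowups\<close>

inductive dominates :: "('v, 'e) wgraph \<Rightarrow> ('v, 'e) wgraph \<Rightarrow> bool" for \<Gamma> where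
  iso: "\<lbrakk>rational_graph G; \<Gamma> \<cong> G\<rbrakk> \<Longrightarrow> dominates \<Gamma> G"
| blowup: "\<lbrakk>dominates \<Gamma> G; contracts H v G\<rbrakk> \<Longrightarrow> dominates \<Gamma> H"

lemma dominates_rational: "dominates \<Gamma> G \<Longrightarrow> rational_graph G"
  by (induction rule: dominates.induct) (auto dest: contractsD(1))

lemma dominates_rigid:
  assumes "dominates \<Gamma> G" "rational_graph \<Gamma>" "rigid \<Gamma>"
  shows "rigid G"
  using assms(1)
proof (induction rule: dominates.induct)
  case (iso G)
  then show ?case
    using isomorphic_iff[OF assms(2) iso(1)] iso_by_inv rigid_iso assms(3) by blast
next
  case (blowup G H v)
  then show ?case using rigid_blowup[OF blowup.hyps(2)] by blast
qed

lemma iso_by_contracts: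
  fixes H H' :: "('v, 'e::infinite) wgraph"
  assumes HG: "contracts H v G" and iso: "iso_by f H H'" and H': "rational_graph H'"
  obtains G' where "contracts H' (f v) G'" "G \<cong> G'"
proof -
  note C = contractsD[OF HG]
  have "f v \<in> verts H'" using iso C(3) by (auto simp: iso_by_def dest: bij_betwE)
  moreover have "weight H' (f v) = -1" "mult H' (f v) (f v) = 0"
    using iso C(3,5,6) by (auto simp: iso_by_def)
  moreover have "valency H' (f v) = 1 \<or> valency H' (f v) = 2"
    using iso_by_valency[OF iso C(3)] C(7) by simp
  ultimately obtain G' where G': "contracts H' (f v) G'"
    using contraction_exists[OF H'] by metis
  have "iso_by f G G'" using contracts_cong[OF HG G' iso] by simp
  then show ?thesis using that[OF G'] iso_by_imp_isomorphic C(2) contractsD(2)[OF G'] by metis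
qed

text \<open>\<open>dominates\<close> admits an isomorphism only at the root \<Gamma>. One at the top
  is pushed down step by step, since each contraction can be transported along it.\<close>

lemma dominates_isomorphic:
  fixes \<Gamma> :: "('v, 'e::infinite) wgraph"
  assumes "dominates \<Gamma> G" "rational_graph \<Gamma>" "rational_graph G'" "G \<cong> G'"
  shows "dominates \<Gamma> G'"
  using assms(1,3,4)
proof (induction arbitrary: G' rule: dominates.induct)
  case (iso G)
  then show ?case using isomorphic_trans[OF assms(2)] dominates.iso by metis
next
  case (blowup G H v H')
  then obtain f where "iso_by f H H'"
    using isomorphic_iff contractsD(1) by metis
  then obtain G' where "contracts H' (f v) G'" "G \<cong> G'"
    using iso_by_contracts blowup by metis
  then show ?case using blowup.IH contractsD(2) dominates.blowup by metis
qed

lemma contracts_not_minimal: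
  assumes "contracts H v G"
  shows "\<not> minimal H"
  using contractsD[OF assms] minimal_iff by force

text \<open>Without an edge between \<open>u\<close> and \<open>v\<close>, contracting one leaves
  the multiplicities at the other unchanged. Their contributions to weights and multiplicities then
  simply add, in either order.\<close>

lemma contractions_commute:
  fixes H :: "('v, 'e::infinite) wgraph"
  assumes Hu: "contracts H u G" and Hv: "contracts H v G'" and "u \<noteq> v" and uv: "mult H u v = 0"
  obtains G'' where "contracts G v G''" "contracts G' u G''"
proof -
  note U = contractsD[OF Hu] and V = contractsD[OF Hv]
  have vu: "mult H v u = 0" using uv by (simp add: mult_commute)
  have mem: "v \<in> verts G" "u \<in> verts G'" using U(3,8) V(3,8) \<open>u \<noteq> v\<close> by auto
  have mv: "mult G v x = mult H v x" if "x \<in> verts G" for x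
    using U(10,11) that mem uv by (cases "x = v") auto
  have mu: "mult G' u x = mult H u x" if "x \<in> verts G'" for x
    using V(10,11) that mem vu by (cases "x = u") auto
  have "weight G v = -1" "mult G v v = 0" "valency G v = 1 \<or> valency G v = 2"
    using U(9)[OF mem(1)] mv mem V(5,6,7) uv contracts_valency_0[OF Hu mem(1) uv] by simp_all
  then obtain G'' where G'': "contracts G v G''"
    using contraction_exists[OF U(2) mem(1)] by metis
  note W = contractsD[OF G'']
  have sub: "x \<in> verts G" "x \<in> verts G'" if "x \<in> verts G''" for x
    using that W(4,8) U(4,8) V(4,8) mem by auto
  have "verts G'' = verts G' - {u}" using W(4,8) U(4,8) V(4,8) mem by auto
  moreover have "weight G' u = -1" "mult G' u u = 0" "valency G' u = 1 \<or> valency G' u = 2"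
    using V(9)[OF mem(2)] mu mem U(5,6,7) vu contracts_valency_0[OF Hv mem(2) vu] by simp_all
  moreover have "weight G'' x = weight G' x + int (mult G' u x) ^ 2" if "x \<in> verts G''" for x
    using W(9)[OF that] U(9)[OF sub(1)[OF that]] V(9)[OF sub(2)[OF that]] mu[OF sub(2)[OF that]]
      mv[OF sub(1)[OF that]] by simp
  moreover have "mult G'' x y = mult G' x y +
      (if x = y then mult G' u x choose 2 else mult G' u x * mult G' u y)"
    if "x \<in> verts G''" "y \<in> verts G''" for x y
  proof (cases "x = y")
    case True
    then show ?thesis
      using W(11)[OF that(1)] U(11)[OF sub(1)[OF that(1)]] V(11)[OF sub(2)[OF that(1)]]
        mu[OF sub(2)[OF that(1)]] mv[OF sub(1)[OF that(1)]] by simp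
  next
    case False
    then show ?thesis
      using W(10)[OF that False] U(10)[OF sub(1)[OF that(1)] sub(1)[OF that(2)] False]
        V(10)[OF sub(2)[OF that(1)] sub(2)[OF that(2)] False]
        mu[OF sub(2)[OF that(1)]] mv[OF sub(1)[OF that(1)]]
        mu[OF sub(2)[OF that(2)]] mv[OF sub(1)[OF that(2)]] by simp
  qed
  ultimately have "contracts G' u G''"
    using V(2) W(2) mem unfolding contracts_def by auto
  then show ?thesis using G'' by (rule that[rotated])
qed

text \<open>Since \<open>v\<close> has weight 0 in the rigid graph \<open>G\<close>, \<open>u\<close> and \<open>v\<close> have the same further neighbours in
  \<open>H\<close>, so exchanging them is an automorphism of \<open>H\<close>.\<close>

lemma adjacent_contractions_isomorphic:
  fixes H :: "('v, 'e::infinite) wgraph"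
  assumes Hu: "contracts H u G" and Hv: "contracts H v G'" and "u \<noteq> v" and uv: "mult H u v \<noteq> 0"
    and G: "rigid G"
  shows "G \<cong> G'"
proof -
  note U = contractsD[OF Hu] and V = contractsD[OF Hv]
  have comm: "mult H x y = mult H y x" for x y by (rule mult_commute)
  have vG: "v \<in> verts G" using U(8) V(3) \<open>u \<noteq> v\<close> by auto
  have le: "mult H u v + mult H u x \<le> 2" "mult H u v + mult H v x \<le> 2"
    if "x \<in> verts H" "x \<noteq> u" "x \<noteq> v" for x
    using mult_sum_le_valency[OF U(1), of "{v, x}" u] mult_sum_le_valency[OF U(1), of "{u, x}" v]
      that U(3,7) V(3,7) comm[of v u] by auto
  have same: "mult H u x = mult H v x" if x: "x \<in> verts H" "x \<noteq> u" "x \<noteq> v" for x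
  proof (cases "mult H u v = 1")
    case True
    have xG: "x \<in> verts G" using x U(8) by auto
    \<comment> \<open>Contracting \<open>u\<close> raises the weight of \<open>v\<close> from -1 to
      0, so evenness in \<open>G\<close> applies. It makes the sum of two numbers, each at most 1,
      even; hence they agree.\<close>
    have "valency G v \<le> 2" "mult G v v = 0" "weight G v = 0"
      using contracts_valency_1[OF Hu vG True] U(7,9,11) V(5,6,7) vG True by auto
    then have "even (mult G v x)" using rigidD(2)[OF G vG] xG by simp
    then have "even (mult H v x + mult H u x)" using U(10)[OF vG xG] True x by simp
    moreover have "mult H v x \<le> 1" "mult H u x \<le> 1" using le[OF x] True by simp_all
    ultimately show ?thesis by presburger
  next
    case False
    \<comment> \<open>Here \<open>v\<close> does not become a 0-vertex. Instead the double edge uses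
      up the valency of both vertices, and neither has a further neighbour.\<close>
    then have "2 \<le> mult H u v" using uv by simp
    then show ?thesis using le[OF x] by simp
  qed
  define f where "f = (\<lambda>x. if x = u then v else if x = v then u else x)"
  have "bij_betw f (verts H) (verts H)"
    using U(3) V(3) by (auto simp: bij_betw_def inj_on_def f_def)
  moreover have "weight H (f x) = weight H x" for x
    using U(5) V(5) by (simp add: f_def)
  moreover have "mult H (f x) (f y) = mult H x y" if "x \<in> verts H" "y \<in> verts H" for x y
    using that same U(6) V(6) comm unfolding f_def by (simp split: if_split) metis
  ultimately have "iso_by f H H" by (simp add: iso_by_def)
  moreover have "f u = v" by (simp add: f_def)
  ultimately have "iso_by f G G'" using contracts_cong[OF Hu Hv] by blast
  then show ?thesis using iso_by_imp_isomorphic U(2) V(2) by blast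
qed

text \<open>Induction on the blowups leading to \<open>H\<close>, comparing \<open>v\<close> with
  the vertex \<open>u\<close> created last. When the two contractions commute, \<open>v\<close> is
  contracted one level earlier and \<open>u\<close> is blown up again. At the root nothing can be
  contracted because \<Gamma> is minimal.\<close>

lemma dominates_contraction:
  fixes \<Gamma> :: "('v, 'e::infinite) wgraph"
  assumes \<Gamma>: "rational_graph \<Gamma>" "minimal \<Gamma>" "rigid \<Gamma>"
    and "dominates \<Gamma> H" "contracts H v G'"
  shows "dominates \<Gamma> G'"
  using assms(4,5)
proof (induction arbitrary: v G' rule: dominates.induct)
  case (iso G)
  obtain f where "iso_by f G \<Gamma>"
    using iso isomorphic_iff[OF \<Gamma>(1) iso(1)] iso_by_inv by metis
  then have False
    using iso_by_contracts[OF iso(3) _ \<Gamma>(1)] contracts_not_minimal \<Gamma>(2) by metis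
  then show ?case ..
next
  case (blowup G H u)
  have rG: "rational_graph G'" using contractsD(2)[OF blowup.prems] .
  consider "u = v" | "u \<noteq> v" "mult H u v = 0" | "u \<noteq> v" "mult H u v \<noteq> 0" by blast
  then show ?case
  proof cases
    case 1
    then have "G \<cong> G'" using contracts_unique blowup by metis
    then show ?thesis using dominates_isomorphic \<Gamma>(1) rG blowup.hyps by metis
  next
    case 2
    then obtain G'' where "contracts G v G''" "contracts G' u G''"
      using contractions_commute blowup by metis
    then show ?thesis using blowup.IH dominates.blowup by metis
  next
    case 3
    have "rigid G" using blowup.hyps(1) \<Gamma>(1,3) by (rule dominates_rigid)
    then have "G \<cong> G'"
      using adjacent_contractions_isomorphic 3 blowup by metis
    then show ?thesis using dominates_isomorphic \<Gamma>(1) rG blowup.hyps by metis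
  qed
qed

text \<open>A birational chain might a priori pass through graphs with non-rational vertices. A
  blowup only adds a rational vertex and keeps the status of the others, so a blowdown cannot
  introduce one.\<close>

lemma blowdown_rational:
  assumes "weighted_graph G" "blowup G H" "rational H = verts H"
  shows "rational_graph G"
proof -
  obtain v where "v \<notin> verts G" "verts H = insert v (verts G)" "rational H = insert v (rational G)"
    using assms(2) unfolding blowup_def inner_blowup_def outer_blowup_def
    by (metis (no_types, lifting) wgraph.select_convs(1,5))
  moreover have "rational G \<subseteq> verts G" using assms(1) by (simp add: weighted_graph_def)
  ultimately have "rational G = verts G" using assms(3) by (metis insert_ident subsetD)
  then show ?thesis using assms(1) by (simp add: rational_graph_def)
qed

lemma birational_dominates:
  fixes \<Gamma> :: "('v, 'e::infinite) wgraph"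
  assumes \<Gamma>: "rational_graph \<Gamma>" "minimal \<Gamma>" "rigid \<Gamma>" and "birational \<Gamma> G"
  shows "dominates \<Gamma> G"
  using assms(4) unfolding birational_def
proof (induction rule: rtranclp_induct)
  case base
  have "iso_by id \<Gamma> \<Gamma>" by (simp add: iso_by_def)
  then show ?case using dominates.iso iso_by_imp_isomorphic \<Gamma>(1) by metis
next
  case (step G H)
  have G: "rational_graph G" using step.IH by (rule dominates_rational)
  have H: "weighted_graph H" and "blowup G H \<or> blowup H G \<or> G \<cong> H"
    using step.hyps by (auto simp: birational_step_def)
  then consider "blowup G H" | "blowup H G" | "G \<cong> H" by blast
  then show ?case
  proof cases
    case 1
    then show ?thesis using blowup_contracts G dominates.blowup step.IH by metis
  next
    case 2
    have "rational_graph H"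
      using blowdown_rational[OF H 2] G by (simp add: rational_graph_def)
    then show ?thesis using blowup_contracts 2 dominates_contraction \<Gamma> step.IH by metis
  next
    case 3
    then show ?thesis
      using dominates_isomorphic[OF step.IH \<Gamma>(1)] isomorphic_imp_iso_by(1)[OF G H] by metis
  qed
qed

lemma rigid_unique_minimal:
  fixes \<Gamma> :: "('v, 'e::infinite) wgraph"
  assumes "rational_graph \<Gamma>" "minimal \<Gamma>" "rigid \<Gamma>" "birational \<Gamma> G" "minimal G"
  shows "\<Gamma> \<cong> G"
  using birational_dominates[OF assms(1-4)] contracts_not_minimal assms(5)
  by (metis dominates.cases)

subsection \<open>Unbounded weights\<close>

text \<open>Connectedness stated through cuts: one crossing edge can be followed through a blowup or
  contraction, whereas paths would have to be rerouted.\<close>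

definition cut_connected :: "('v, 'e) wgraph \<Rightarrow> bool" where
  "cut_connected G \<longleftrightarrow>
     (\<forall>A\<subseteq>verts G. A \<noteq> {} \<longrightarrow> A \<noteq> verts G \<longrightarrow> (\<exists>x\<in>A. \<exists>y\<in>verts G - A. mult G x y \<noteq> 0))"

lemma cut_connectedE:
  assumes "cut_connected G" "A \<subseteq> verts G" "A \<noteq> {}" "A \<noteq> verts G"
  obtains x y where "x \<in> A" "y \<in> verts G" "y \<notin> A" "mult G x y \<noteq> 0"
  using assms unfolding cut_connected_def by blast

text \<open>Both \<open>A\<close> and \<open>insert v A\<close> are cuts of \<open>H\<close>. A
  crossing edge avoiding \<open>v\<close> survives. Otherwise \<open>v\<close> has a neighbour
  inside \<open>A\<close> and one outside, and the contraction joins these two.\<close>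

lemma cut_connected_contraction:
  assumes "contracts H v G" "cut_connected H"
  shows "cut_connected G"
  unfolding cut_connected_def
proof (intro allI impI)
  fix A assume A: "A \<subseteq> verts G" "A \<noteq> {}" "A \<noteq> verts G"
  note C = contractsD[OF assms(1)]
  have sub: "A \<subseteq> verts H" "A \<noteq> verts H" "insert v A \<subseteq> verts H" "insert v A \<noteq> verts H"
    using A C(3,4,8) by auto
  obtain x y where xy: "x \<in> A" "y \<in> verts H" "y \<notin> A" "mult H x y \<noteq> 0"
    using cut_connectedE[OF assms(2) sub(1) A(2) sub(2)] .
  obtain x' y' where xy': "x' \<in> insert v A" "y' \<in> verts H" "y' \<notin> insert v A" "mult H x' y' \<noteq> 0"
    using cut_connectedE[OF assms(2) sub(3) insert_not_empty sub(4)] .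
  show "\<exists>x\<in>A. \<exists>y\<in>verts G - A. mult G x y \<noteq> 0"
  proof (cases "y = v")
    case False
    then show ?thesis using xy A C(8) C(10)[of x y] by fastforce
  next
    case y: True
    show ?thesis
    proof (cases "x' = v")
      case False
      then show ?thesis using xy' A C(8) C(10)[of x' y'] by fastforce
    next
      case True
      then have "mult H v x * mult H v y' \<noteq> 0" using xy xy' y by (simp add: mult_commute)
      moreover have "x \<in> verts G" "y' \<in> verts G" "x \<noteq> y'" "y' \<notin> A" using xy xy' A C(8) by auto
      ultimately show ?thesis
        using C(10)[of x y'] xy(1) by (intro bexI[of _ x] bexI[of _ y']) auto
    qed
  qed
qed

text \<open>An edge of \<open>G\<close> crossing the cut \<open>A - {v}\<close> either exists in
  \<open>H\<close> or came from two edges through \<open>v\<close>; in the latter case one of these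
  two crosses, whichever side \<open>v\<close> is on. If \<open>v\<close> alone is one side, its
  edge to \<open>a\<close> crosses.\<close>

lemma cut_connected_blowup:
  assumes "contracts H v G" "cut_connected G"
  shows "cut_connected H"
  unfolding cut_connected_def
proof (intro allI impI)
  fix A assume A: "A \<subseteq> verts H" "A \<noteq> {}" "A \<noteq> verts H"
  note C = contractsD[OF assms(1)]
  have "\<exists>a\<in>verts G. mult H v a \<noteq> 0"
    using contracts_valency(1)[OF assms(1)] C(7) by (metis sum.neutral zero_neq_numeral zero_neq_one)
  then obtain a where a: "a \<in> verts G" "mult H v a \<noteq> 0" "mult H a v \<noteq> 0"
    by (auto simp: mult_commute)
  show "\<exists>x\<in>A. \<exists>y\<in>verts H - A. mult H x y \<noteq> 0"
  proof (cases "A - {v} = {} \<or> A - {v} = verts G")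
    case True
    then have "A = {v} \<or> A = verts G" using A C(4,8) by auto
    then show ?thesis using a C(4,8) by auto
  next
    case False
    then obtain x y where xy: "x \<in> A - {v}" "y \<in> verts G" "y \<notin> A - {v}" "mult G x y \<noteq> 0"
      using cut_connectedE[OF assms(2), of "A - {v}"] A C(8) by (metis Diff_subset_conv Un_insert_left sup_bot_left)
    have mem: "x \<in> verts G" "x \<in> A" "y \<noteq> v" "y \<in> verts H" "y \<notin> A" "x \<noteq> y"
      using xy A C(4,8) by auto
    then have "mult H x y + mult H v x * mult H v y \<noteq> 0"
      using C(10)[of x y] xy by simp
    then consider "mult H x y \<noteq> 0" | "mult H v x \<noteq> 0" "mult H v y \<noteq> 0" by fastforce
    then show ?thesis
    proof cases
      case 1
      then show ?thesis using mem by blast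
    next
      case 2
      show ?thesis
      proof (cases "v \<in> A")
        case True
        then show ?thesis using 2(2) mem by blast
      next
        case False
        moreover have "mult H x v \<noteq> 0" using 2(1) by (simp add: mult_commute)
        ultimately show ?thesis using mem C(3) by blast
      qed
    qed
  qed
qed

section \<open>Contractions as birational moves\<close>

lemma birational_trans: "\<lbrakk>birational G H; birational H K\<rbrakk> \<Longrightarrow> birational G K"
  unfolding birational_def by (rule rtranclp_trans)

lemma birational_stepI:
  assumes "rational_graph G" "rational_graph H" "blowup G H \<or> blowup H G \<or> G \<cong> H"
  shows "birational G H"
  using assms unfolding birational_def birational_step_def rational_graph_def
  by (intro r_into_rtranclp) auto

text \<open>The multiplicities at \<open>v\<close> tell which blowup of \<open>G\<close> to perform:
  at its unique neighbour if the valency is 1, in an edge between its two neighbours (possibly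
  equal) if it is 2. The result has the same data as \<open>H\<close> and is therefore isomorphic to
  it.\<close>

lemma contracts_birational:
  fixes G :: "('v::infinite, 'e::infinite) wgraph"
  assumes HG: "contracts H v G"
  shows "birational G H" "birational H G"
proof -
  note C = contractsD[OF HG]
  have fin: "finite (verts G)" using C(2) by (rule rational_graphD)
  have "\<exists>H' v'. blowup G H' \<and> contracts H' v' G \<and> (\<forall>x\<in>verts G. mult H v x = mult H' v' x)"
    using C(7)
  proof
    assume "valency H v = 1"
    then obtain a where a: "a \<in> verts G" "mult H v a = 1" "\<And>b. b \<in> verts G \<Longrightarrow> a \<noteq> b \<Longrightarrow> mult H v b = 0"
      using contracts_valency(1)[OF HG] sum_eq_1_iff[OF fin] by metis
    obtain H' v' where "blowup G H'" "contracts H' v' G"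
      "\<And>x. x \<in> verts G \<Longrightarrow> mult H' v' x = of_bool (x = a)"
      using outer_blowup_exists[OF C(2) a(1)] by blast
    moreover have "mult H v x = of_bool (x = a)" if "x \<in> verts G" for x
      using a that by (cases "x = a") auto
    ultimately show ?thesis by metis
  next
    assume two: "valency H v = 2"
    then obtain a where a: "a \<in> verts G" "mult H v a \<noteq> 0"
      using contracts_valency(1)[OF HG] by (metis sum.neutral zero_neq_numeral)
    \<comment> \<open>Removing one edge end at \<open>a\<close> leaves total 1, which locates the
      other end \<open>b\<close>; this covers \<open>a = b\<close> as well.\<close>
    define c where "c x = mult H v x - of_bool (x = a)" for x
    have mc: "mult H v x = of_bool (x = a) + c x" for x using a by (simp add: c_def)
    have "(\<Sum>x\<in>verts G. mult H v x) = 1 + (\<Sum>x\<in>verts G. c x)"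
      unfolding mc using fin a by (simp add: sum.distrib)
    then have "sum c (verts G) = 1" using two contracts_valency(1)[OF HG] by simp
    then obtain b where b: "b \<in> verts G" "c b = 1" "\<And>x. x \<in> verts G \<Longrightarrow> b \<noteq> x \<Longrightarrow> c x = 0"
      using sum_eq_1_iff[OF fin] by metis
    have mab: "mult H v x = of_bool (x = a) + of_bool (x = b)" if "x \<in> verts G" for x
      using b mc[of x] that by (cases "x = b") auto
    \<comment> \<open>The edge to be blown up exists because the contraction itself created
      one.\<close>
    have "0 < mult G a b"
      using C(10)[OF a(1) b(1)] C(11)[OF a(1)] mab[OF a(1)] mab[OF b(1)] by (cases "a = b") auto
    then obtain H' v' where "blowup G H'" "contracts H' v' G"
      "\<And>x. x \<in> verts G \<Longrightarrow> mult H' v' x = of_bool (x = a) + of_bool (x = b)"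
      using inner_blowup_exists[OF C(2)] by blast
    then show ?thesis using mab by metis
  qed
  then obtain H' v' where H': "blowup G H'" "contracts H' v' G" "H \<cong> H'"
    using blowups_isomorphic[OF HG] by blast
  have rH': "rational_graph H'" using contractsD(1)[OF H'(2)] .
  have "birational G H'" "birational H' H" "birational H H'" "birational H' G"
    using H' rH' C(1,2) isomorphic_sym[OF C(1) rH'] by (auto intro!: birational_stepI)
  then show "birational G H" "birational H G" using birational_trans by blast+
qed

text \<open>\<open>cut_connected\<close> is carried along for the later passage to a minimal
  graph.\<close>

definition unbounded_class :: "('v, 'e) wgraph \<Rightarrow> bool" where
  "unbounded_class G \<longleftrightarrow> (\<forall>k. \<exists>H. birational G H \<and> rational_graph H \<and> cut_connected H \<and>
     (\<exists>x\<in>verts H. k \<le> weight H x))"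

lemma unbounded_class_blowup:
  fixes G :: "('v::infinite, 'e::infinite) wgraph"
  assumes "contracts H v G" "unbounded_class H"
  shows "unbounded_class G"
  using assms(2) contracts_birational(1)[OF assms(1)] birational_trans
  unfolding unbounded_class_def by metis

text \<open>Blow up on the side of \<open>v\<close> away from \<open>a\<close>: at \<open>v\<close>
  itself if \<open>a\<close> is its only neighbour, otherwise in the edge to the other neighbour
  \<open>b\<close>. This leaves \<open>a\<close> untouched and turns \<open>v\<close> into a
  (-1)-vertex. Contracting \<open>v\<close> adds 1 to the weight of \<open>a\<close>, and the new
  vertex \<open>u\<close> takes over as the 0-vertex next to \<open>a\<close>.\<close>

lemma elementary_transformation:
  fixes G :: "('v::infinite, 'e::infinite) wgraph"
  assumes G: "rational_graph G" "cut_connected G" and v: "v \<in> verts G" "weight G v = 0"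
    "mult G v v = 0" "valency G v \<le> 2" and a: "a \<in> verts G" "mult G v a = 1"
  obtains G' u where "birational G G'" "rational_graph G'" "cut_connected G'" "u \<in> verts G'"
    "weight G' u = 0" "mult G' u u = 0" "valency G' u \<le> 2" "a \<in> verts G'" "mult G' u a = 1"
    "weight G' a = weight G a + 1"
proof -
  have fin: "finite (verts G)" using G(1) by (rule rational_graphD)
  have "a \<noteq> v" using v a by auto
  have "\<exists>H u. contracts H u G \<and> mult H u v = 1 \<and> mult H u a = 0 \<and> valency H v = 2"
  proof (cases "valency G v = 1")
    case True
    obtain H u where H: "contracts H u G" "\<And>x. x \<in> verts G \<Longrightarrow> mult H u x = of_bool (x = v)"
      using outer_blowup_exists[OF G(1) v(1)] by blast
    then have "valency H u = 1"
      using contracts_valency(1)[OF H(1)] fin v by simp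
    then have "valency H v = 2" using contracts_valency_1[OF H(1) v(1)] H(2)[OF v(1)] True by simp
    then show ?thesis
      using H v a \<open>a \<noteq> v\<close> by (intro exI[of _ H] exI[of _ u]) auto
  next
    case False
    then have two: "valency G v = 2" using mult_le_valency[OF G(1) a(1), of v] v a by linarith
    have "valency G v = mult G v a + sum (mult G v) (verts G - {a})"
      unfolding valency_def using fin a by (intro sum.remove)
    then have "sum (mult G v) (verts G - {a}) = 1" using two a by simp
    then obtain b where b: "b \<in> verts G - {a}" "mult G v b = 1"
      using sum_eq_1_iff[of "verts G - {a}" "mult G v"] fin by auto
    have "0 < mult G v b" using b by simp
    then obtain H u where H: "contracts H u G"
      "\<And>x. x \<in> verts G \<Longrightarrow> mult H u x = of_bool (x = v) + of_bool (x = b)"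
      using inner_blowup_exists[OF G(1)] by blast
    then have "valency H u = 2"
      using contracts_valency(1)[OF H(1)] fin v b by (simp add: sum.distrib)
    moreover have "mult H u v = 1" using H(2)[OF v(1)] b v(3) by auto
    ultimately have "valency H v = 2" using contracts_valency_1[OF H(1) v(1)] two by simp
    then show ?thesis
      using H \<open>mult H u v = 1\<close> v a b \<open>a \<noteq> v\<close> by (intro exI[of _ H] exI[of _ u]) auto
  qed
  then obtain H u where H: "contracts H u G" "mult H u v = 1" "mult H u a = 0" "valency H v = 2"
    by blast
  note C = contractsD[OF H(1)]
  have vH: "v \<in> verts H" "weight H v = -1" "mult H v v = 0" "mult H v a = 1"
    using C(8) C(9)[OF v(1)] C(10)[OF v(1) a(1)] C(11)[OF v(1)] v a H \<open>a \<noteq> v\<close> by auto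
  obtain G' where G': "contracts H v G'"
    using contraction_exists[OF C(1) vH(1-3)] H(4) by blast
  note D = contractsD[OF G']
  have "u \<noteq> v" "u \<noteq> a" using C(4) v a by auto
  then have mem: "u \<in> verts G'" "a \<in> verts G'" using C(3,8) D(8) a \<open>a \<noteq> v\<close> by auto
  have vu: "mult H v u = 1" using H(2) by (simp add: mult_commute)
  have "birational G G'"
    using contracts_birational(1)[OF H(1)] contracts_birational(2)[OF G'] by (rule birational_trans)
  moreover have "cut_connected G'"
    using cut_connected_contraction[OF G'] cut_connected_blowup[OF H(1)] G(2) by blast
  moreover have "weight G' u = 0" "mult G' u u = 0" using D(9,11)[OF mem(1)] vu C(5,6) by simp_all
  moreover have "valency G' u \<le> 2"
    using contracts_valency_1[OF G' mem(1) vu] H(4) C(7) by auto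
  moreover have "mult G' u a = 1" using D(10)[OF mem \<open>u \<noteq> a\<close>] vu vH(4) H(3) by simp
  moreover have "weight G' a = weight G a + 1"
    using D(9)[OF mem(2)] C(9)[OF a(1)] H(3) vH(4) by simp
  ultimately show ?thesis using that D(2) mem by blast
qed

lemma unbounded_class_zero:
  fixes G :: "('v::infinite, 'e::infinite) wgraph"
  assumes "rational_graph G" "cut_connected G" "v \<in> verts G" "weight G v = 0"
    "mult G v v = 0" "valency G v \<le> 2" "a \<in> verts G" "mult G v a = 1"
  shows "unbounded_class G"
proof -
  have "\<exists>H. birational G H \<and> rational_graph H \<and> cut_connected H \<and>
      (\<exists>x\<in>verts H. weight G a + int n \<le> weight H x)" for n
    using assms
  \<comment> \<open>The vertex \<open>a\<close> stays fixed while the 0-vertex is replaced at every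
    step.\<close>
  proof (induction n arbitrary: G v)
    case 0
    then have "birational G G" by (simp add: birational_def)
    then show ?case using 0 by auto
  next
    case (Suc n)
    obtain G' u where G': "birational G G'" "rational_graph G'" "cut_connected G'" "u \<in> verts G'"
      "weight G' u = 0" "mult G' u u = 0" "valency G' u \<le> 2" "a \<in> verts G'" "mult G' u a = 1"
      "weight G' a = weight G a + 1"
      using elementary_transformation[OF Suc.prems] .
    obtain H where "birational G' H" "rational_graph H" "cut_connected H"
      "\<exists>x\<in>verts H. weight G' a + int n \<le> weight H x"
      using Suc.IH[OF G'(2-9)] by blast
    then show ?case
      using birational_trans[OF G'(1)] G'(10) by (intro exI[of _ H]) (auto simp: algebra_simps)
  qed
  note * = this
  show ?thesis
    unfolding unbounded_class_def
  proof
    fix k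
    have "k \<le> weight G a + int (nat (k - weight G a))" by simp
    then show "\<exists>H. birational G H \<and> rational_graph H \<and> cut_connected H \<and> (\<exists>x\<in>verts H. k \<le> weight H x)"
      using *[of "nat (k - weight G a)"] by (meson order_trans)
  qed
qed

text \<open>Blowing up the edge from \<open>v\<close> to \<open>a\<close> lowers the weight of
  \<open>v\<close> by 1, and the new vertex inherits the role of \<open>a\<close>. Repetition brings
  \<open>v\<close> down to weight 0 with a simple edge.\<close>

lemma unbounded_class_simple_edge:
  fixes G :: "('v::infinite, 'e::infinite) wgraph"
  assumes "rational_graph G" "cut_connected G" "v \<in> verts G" "weight G v = int n"
    "mult G v v = 0" "valency G v \<le> 2" "a \<in> verts G" "mult G v a = 1"
  shows "unbounded_class G"
  using assms
proof (induction n arbitrary: G a)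
  case 0
  then show ?case using unbounded_class_zero[of G v a] by simp
next
  case (Suc n)
  have "a \<noteq> v" using Suc.prems by auto
  have "0 < mult G v a" using Suc.prems by simp
  then obtain H u where H: "contracts H u G"
    "\<And>x. x \<in> verts G \<Longrightarrow> mult H u x = of_bool (x = v) + of_bool (x = a)"
    using inner_blowup_exists[OF Suc.prems(1)] by blast
  note C = contractsD[OF H(1)]
  have c: "mult H u v = 1" using H(2) Suc.prems \<open>a \<noteq> v\<close> by simp
  have "valency H u = 2"
    using contracts_valency(1)[OF H(1)] rational_graphD(1)[OF Suc.prems(1)] H(2) Suc.prems
    by (simp add: sum.distrib)
  then have "valency H v \<le> 2" using contracts_valency_1[OF H(1) Suc.prems(3) c] Suc.prems by simp
  moreover have "weight H v = int n" "mult H v v = 0" "mult H v u = 1"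
    using C(9,11)[OF Suc.prems(3)] c Suc.prems by (simp_all add: mult_commute)
  moreover have "cut_connected H" using cut_connected_blowup[OF H(1)] Suc.prems by blast
  ultimately have "unbounded_class H"
    using Suc.IH[OF C(1), of u] C(3,8) Suc.prems by auto
  then show ?case using unbounded_class_blowup H(1) by blast
qed

text \<open>Blowing up one of the two parallel edges separates them, so \<open>v\<close> gets a
  simple edge. This costs 1 in weight, and positivity keeps the remaining weight
  nonnegative.\<close>

lemma unbounded_class_double_edge:
  fixes G :: "('v::infinite, 'e::infinite) wgraph"
  assumes G: "rational_graph G" "cut_connected G" and v: "v \<in> verts G" "1 \<le> weight G v"
    "mult G v v = 0" "valency G v \<le> 2" and a: "a \<in> verts G" "mult G v a = 2"
  shows "unbounded_class G"
proof -
  have "a \<noteq> v" using v a by auto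
  have "0 < mult G v a" using a by simp
  then obtain H u where H: "contracts H u G"
    "\<And>x. x \<in> verts G \<Longrightarrow> mult H u x = of_bool (x = v) + of_bool (x = a)"
    using inner_blowup_exists[OF G(1)] by blast
  note C = contractsD[OF H(1)]
  have c: "mult H u v = 1" using H(2) v \<open>a \<noteq> v\<close> by simp
  have "valency H u = 2"
    using contracts_valency(1)[OF H(1)] rational_graphD(1)[OF G(1)] H(2) v a
    by (simp add: sum.distrib)
  then have "valency H v \<le> 2" using contracts_valency_1[OF H(1) v(1) c] v by simp
  moreover have "weight H v = int (nat (weight G v - 1))" "mult H v v = 0" "mult H v u = 1"
    using C(9,11)[OF v(1)] c v by (simp_all add: mult_commute)
  moreover have "cut_connected H" using cut_connected_blowup[OF H(1)] G by blast
  ultimately have "unbounded_class H"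
    using unbounded_class_simple_edge[OF C(1), of v "nat (weight G v - 1)" u] C(3,8) v by simp
  then show ?thesis using unbounded_class_blowup H(1) by blast
qed

text \<open>An outer blowup supplies a simple edge at the price of 1 in weight.\<close>

lemma unbounded_class_isolated:
  fixes G :: "('v::infinite, 'e::infinite) wgraph"
  assumes G: "rational_graph G" "cut_connected G" and v: "v \<in> verts G" "1 \<le> weight G v"
    "valency G v = 0"
  shows "unbounded_class G"
proof -
  obtain H u where H: "contracts H u G" "\<And>x. x \<in> verts G \<Longrightarrow> mult H u x = of_bool (x = v)"
    using outer_blowup_exists[OF G(1) v(1)] by blast
  note C = contractsD[OF H(1)]
  have c: "mult H u v = 1" using H(2) v by simp
  have "valency H v \<le> 2" using contracts_valency_1[OF H(1) v(1) c] v by simp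
  moreover have "weight H v = int (nat (weight G v - 1))" "mult H v u = 1"
    using C(9)[OF v(1)] c v by (simp_all add: mult_commute)
  moreover have "mult H v v = 0"
    using C(11)[OF v(1)] c mult_le_valency[OF G(1) v(1), of v] v by simp
  moreover have "cut_connected H" using cut_connected_blowup[OF H(1)] G by blast
  ultimately have "unbounded_class H"
    using unbounded_class_simple_edge[OF C(1), of v "nat (weight G v - 1)" u] C(3,8) v by simp
  then show ?thesis using unbounded_class_blowup H(1) by blast
qed

text \<open>Blowing up the loop costs 4 and yields a double edge; weight at least 5 leaves the
  positive weight needed there.\<close>

lemma unbounded_class_loop:
  fixes G :: "('v::infinite, 'e::infinite) wgraph"
  assumes G: "rational_graph G" "cut_connected G" and v: "v \<in> verts G" "5 \<le> weight G v"
    "mult G v v = 1" "valency G v = 1"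
  shows "unbounded_class G"
proof -
  have "0 < mult G v v" using v by simp
  then obtain H u where H: "contracts H u G"
    "\<And>x. x \<in> verts G \<Longrightarrow> mult H u x = of_bool (x = v) + of_bool (x = v)"
    using inner_blowup_exists[OF G(1)] by blast
  note C = contractsD[OF H(1)]
  have c: "mult H u v = 2" using H(2) v by simp
  have "valency H v \<le> 2" using contracts_valency_2[OF H(1) v(1) c] v by simp
  moreover have "1 \<le> weight H v" "mult H v v = 0" "mult H v u = 2"
    using C(9,11)[OF v(1)] c v by (simp_all add: mult_commute)
  moreover have "cut_connected H" using cut_connected_blowup[OF H(1)] G by blast
  ultimately have "unbounded_class H"
    using unbounded_class_double_edge[OF C(1), of v u] C(3,8) v by auto
  then show ?thesis using unbounded_class_blowup H(1) by blast
qed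

lemma not_rigid_unbounded:
  fixes G :: "('v::infinite, 'e::infinite) wgraph"
  assumes G: "rational_graph G" "cut_connected G" and "\<not> rigid G"
  shows "unbounded_class G"
proof -
  obtain x where x: "x \<in> verts G" and *: "mult G x x = 0 \<and> valency G x \<le> 2 \<and> 0 \<le> weight G x \<and>
      (weight G x \<noteq> 0 \<or> (\<exists>y\<in>verts G. odd (mult G x y))) \<or>
      mult G x x = 1 \<and> valency G x = 1 \<and> 4 < weight G x"
    using \<open>\<not> rigid G\<close> unfolding rigid_def by (meson linorder_not_less)
  show ?thesis
  proof (cases "mult G x x = 0")
    case False
    then show ?thesis using * unbounded_class_loop[OF G x] by auto
  next
    case True
    then have lin: "valency G x \<le> 2" "0 \<le> weight G x" using * by auto
    then have w: "weight G x = int (nat (weight G x))" by simp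
    have simple: ?thesis if "y \<in> verts G" "mult G x y = 1" for y
      using unbounded_class_simple_edge[OF G x w True lin(1) that] .
    show ?thesis
    proof (cases "\<exists>y\<in>verts G. odd (mult G x y)")
      case True
      then obtain y where y: "y \<in> verts G" "odd (mult G x y)" by blast
      have "mult G x y \<le> 2" using mult_le_valency[OF G(1) y(1), of x] lin by linarith
      then have "mult G x y = 1" using y(2) by (auto simp: le_Suc_eq numeral_2_eq_2)
      then show ?thesis using simple y by blast
    next
      case False
      then have pos: "1 \<le> weight G x" using * \<open>mult G x x = 0\<close> lin by auto
      show ?thesis
      proof (cases "valency G x = 0")
        case True
        then show ?thesis using unbounded_class_isolated[OF G x pos] by blast
      next
        case nz: False
        then obtain y where y: "y \<in> verts G" "mult G x y \<noteq> 0"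
          unfolding valency_def by (metis sum.neutral)
        have "mult G x y \<le> 2" using mult_le_valency[OF G(1) y(1), of x] lin by linarith
        then have "mult G x y = 2" using y False by (auto simp: le_Suc_eq numeral_2_eq_2)
        then show ?thesis
          using unbounded_class_double_edge[OF G x pos True lin(1) y(1)] by blast
      qed
    qed
  qed
qed

text \<open>As \<open>k\<close> is nonnegative, \<open>x\<close> never becomes a (-1)-vertex, so it
  is never contracted and its weight can only grow. Since \<open>x\<close> remains as a second
  vertex, connectedness gives every (-1)-vertex a neighbour, and an at most linear one can be
  contracted.\<close>

lemma minimal_model_exists:
  fixes G :: "('v::infinite, 'e::infinite) wgraph"
  assumes "rational_graph G" "cut_connected G" "x \<in> verts G" "k \<le> weight G x" "0 \<le> k"
  shows "\<exists>H. birational G H \<and> rational_graph H \<and> minimal H \<and> (\<exists>x\<in>verts H. k \<le> weight H x)"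
  using assms
proof (induction "card (verts G)" arbitrary: G rule: less_induct)
  case less
  show ?case
  proof (cases "minimal G")
    case True
    then show ?thesis using less.prems by (intro exI[of _ G]) (auto simp: birational_def)
  next
    case False
    then obtain v where v: "v \<in> verts G" "mult G v v = 0" "valency G v \<le> 2" "weight G v = -1"
      using minimal_iff less.prems by blast
    then have "v \<noteq> x" using less.prems by auto
    then obtain y where "y \<in> verts G" "mult G v y \<noteq> 0"
      using cut_connectedE[OF less.prems(2), of "{v}"] v less.prems(3) by (metis empty_not_insert empty_subsetI insert_subset singletonD)
    then have "valency G v = 1 \<or> valency G v = 2"
      using mult_le_valency[OF less.prems(1), of y v] v(3) by linarith
    then obtain G' where G': "contracts G v G'"
      using contraction_exists[OF less.prems(1) v(1,4,2)] by blast
    note C = contractsD[OF G']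
    have "card (verts G') < card (verts G)"
      using C(4,8) rational_graphD(1)[OF C(2)] by simp
    moreover have x: "x \<in> verts G'" using C(8) \<open>v \<noteq> x\<close> less.prems by auto
    moreover have "k \<le> weight G' x" using C(9)[OF x] less.prems(4) by (metis add_increasing2 zero_le_power2)
    ultimately obtain H where "birational G' H" "rational_graph H" "minimal H"
      "\<exists>x\<in>verts H. k \<le> weight H x"
      using less.hyps[OF _ C(2) cut_connected_contraction[OF G' less.prems(2)]] less.prems(5) by blast
    then show ?thesis
      using birational_trans[OF contracts_birational(2)[OF G']] by blast
  qed
qed

text \<open>The maximal weight is an isomorphism invariant taking infinitely many values on the
  minimal graphs of the class; one graph is chosen for each value.\<close>

lemma unbounded_infinite_minimal:
  fixes \<Gamma> :: "('v::infinite, 'e::infinite) wgraph"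
  assumes "unbounded_class \<Gamma>"
  shows "\<exists>\<S>. infinite \<S> \<and> (\<forall>G\<in>\<S>. birational \<Gamma> G \<and> weighted_graph G \<and> minimal G) \<and>
    (\<forall>G\<in>\<S>. \<forall>H\<in>\<S>. G \<noteq> H \<longrightarrow> \<not> G \<cong> H)"
proof -
  define M where "M = {G. birational \<Gamma> G \<and> rational_graph G \<and> minimal G}"
  define top where "top G = Max (weight G ` verts G)" for G :: "('v, 'e) wgraph"
  have top_iso: "top G = top H" if GH: "G \<in> M" "H \<in> M" "G \<cong> H" for G H
  proof -
    obtain f where "iso_by f G H" using GH isomorphic_iff unfolding M_def by blast
    then have "weight H ` verts H = weight G ` verts G"
      unfolding iso_by_def by (metis (no_types, lifting) bij_betw_imp_surj_on image_cong image_image)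
    then show ?thesis by (simp add: top_def)
  qed
  have "\<exists>G\<in>M. k \<le> top G" for k
  proof -
    obtain H x where "birational \<Gamma> H" "rational_graph H" "cut_connected H" "x \<in> verts H" "max 0 k \<le> weight H x"
      using assms unfolding unbounded_class_def by metis
    then obtain G y where G: "birational \<Gamma> G" "rational_graph G" "minimal G" "y \<in> verts G" "max 0 k \<le> weight G y"
      using minimal_model_exists[of H x "max 0 k"] birational_trans by (metis max.cobounded1)
    have "weight G y \<le> top G"
      unfolding top_def using G(4) rational_graphD(1)[OF G(2)] by (intro Max_ge) auto
    then show ?thesis using G by (auto simp: M_def intro!: bexI[of _ G])
  qed
  note large = this
  have inf: "infinite (top ` M)"
  proof
    assume fin: "finite (top ` M)"
    obtain G where "G \<in> M" "Max (top ` M) + 1 \<le> top G" using large by blast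
    moreover from this have "top G \<le> Max (top ` M)" using fin by (intro Max_ge) auto
    ultimately show False by simp
  qed
  define \<S> where "\<S> = inv_into M top ` (top ` M)"
  have "infinite \<S>"
    unfolding \<S>_def using inf by (metis finite_image_iff inj_on_inv_into subset_refl)
  moreover have "\<S> \<subseteq> M" unfolding \<S>_def by (auto intro: inv_into_into)
  moreover have "G = H" if "G \<in> \<S>" "H \<in> \<S>" "G \<cong> H" for G H
  proof -
    have "top G = top H" using top_iso that \<open>\<S> \<subseteq> M\<close> by blast
    then show ?thesis using that(1,2) by (auto simp: \<S>_def f_inv_into_f)
  qed
  ultimately show ?thesis
    by (intro exI[of _ \<S>]) (auto simp: M_def rational_graph_def)
qed

subsection \<open>Chains and cycles\<close>

lemma rational_chain: "ws \<noteq> [] \<Longrightarrow> rational_graph (chain ws)"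
  by (auto simp: rational_graph_def weighted_graph_def chain_def)

lemma rational_cycle: "ws \<noteq> [] \<Longrightarrow> rational_graph (cycle ws)"
  by (auto simp: rational_graph_def weighted_graph_def cycle_def)

lemma mult_chain:
  assumes "i < length ws" "j < length ws"
  shows "mult (chain ws) i j = of_bool (j = Suc i) + of_bool (i = Suc j)"
proof -
  have "{e \<in> edges (chain ws). ends (chain ws) e = Upair i j} =
      (if j = Suc i then {i} else {}) \<union> (if i = Suc j then {j} else {})"
    using assms by (auto simp: chain_def)
  then show ?thesis by (simp add: mult_def)
qed

text \<open>At length 2 both indicators hold, which is the double edge. For \<open>i = j\<close> the
  two singletons in the proof would coincide, so loops are treated separately.\<close>

lemma mult_cycle:
  assumes "i < length ws" "j < length ws" "i \<noteq> j"
  shows "mult (cycle ws) i j =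
    of_bool (j = Suc i mod length ws) + of_bool (i = Suc j mod length ws)"
proof -
  have "{e \<in> edges (cycle ws). ends (cycle ws) e = Upair i j} =
      (if j = Suc i mod length ws then {i} else {}) \<union> (if i = Suc j mod length ws then {j} else {})"
    using assms by (auto simp: cycle_def)
  then show ?thesis using assms(3) by (simp add: mult_def)
qed

lemma mult_cycle_same:
  assumes "i < length ws"
  shows "mult (cycle ws) i i = of_bool (length ws = 1)"
proof -
  have "{e \<in> edges (cycle ws). ends (cycle ws) e = Upair i i} =
      (if Suc i mod length ws = i then {i} else {})"
    using assms by (auto simp: cycle_def)
  moreover have "Suc i mod length ws = i \<longleftrightarrow> length ws = 1"
    using assms by (cases "Suc i = length ws") auto
  ultimately show ?thesis by (simp add: mult_def)
qed

text \<open>A longest simple path exhausts the vertices. The degree bound then fixes all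
  multiplicities except the one between its two ends, which decides between chain and cycle.\<close>

lemma max_valency_2_classification:
  fixes S :: "('v, 'e) wgraph"
  assumes S: "rational_graph S" "cut_connected S"
    and deg: "\<And>x. x \<in> verts S \<Longrightarrow> valency S x + mult S x x \<le> 2"
  shows "is_linear S \<or> is_circular S"
proof -
  define path where "path p n \<longleftrightarrow> inj_on p {..<n} \<and> p ` {..<n} \<subseteq> verts S \<and>
    (\<forall>i. Suc i < n \<longrightarrow> mult S (p i) (p (Suc i)) \<noteq> 0)" for p :: "nat \<Rightarrow> 'v" and n
  have fin: "finite (verts S)" using S(1) by (rule rational_graphD)
  obtain x0 where x0: "x0 \<in> verts S" using rational_graphD(2)[OF S(1)] by blast
  have "path (\<lambda>_. x0) 1" using x0 by (auto simp: path_def inj_on_def)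
  then have path1: "\<exists>p. path p 1" by blast
  have bound: "k \<le> card (verts S)" if "\<exists>p. path p k" for k
    using that card_inj_on_le[OF _ _ fin, of _ "{..<k}"] unfolding path_def by auto
  define n where "n = (GREATEST k. \<exists>p. path p k)"
  have n: "\<exists>p. path p n"
    unfolding n_def using path1 bound by (rule GreatestI_nat)
  have max: "k \<le> n" if "\<exists>p. path p k" for k
    unfolding n_def using that bound by (rule Greatest_le_nat)
  have n1: "1 \<le> n" using max path1 by blast
  obtain p where p: "path p n" using n by blast
  then have inj: "inj_on p {..<n}" and pV: "p ` {..<n} \<subseteq> verts S"
    and edge: "\<And>i. Suc i < n \<Longrightarrow> mult S (p i) (p (Suc i)) \<noteq> 0"
    by (auto simp: path_def)
  have neq: "p i \<noteq> p j" if "i < n" "j < n" "i \<noteq> j" for i j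
    using inj that by (auto simp: inj_on_eq_iff)
  have mem: "p i \<in> verts S" if "i < n" for i using pV that by auto
  have edge': "mult S (p (Suc i)) (p i) \<noteq> 0" if "Suc i < n" for i
    using edge[OF that] by (simp add: mult_commute)
  have val: "sum (mult S x) A \<le> 2" if "x \<in> verts S" "A \<subseteq> verts S" for x A
    using mult_sum_le_valency[OF S(1) that(2), of x] deg[OF that(1)] by linarith
  have surj: "p ` {..<n} = verts S"
  proof (rule ccontr)
    assume "p ` {..<n} \<noteq> verts S"
    moreover have "p ` {..<n} \<noteq> {}" using n1 by (auto simp: lessThan_empty_iff)
    ultimately obtain i y where iy: "i < n" "y \<in> verts S" "y \<notin> p ` {..<n}" "mult S (p i) y \<noteq> 0"
      using cut_connectedE[OF S(2) pV] by (metis imageE lessThan_iff)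
    \<comment> \<open>A new neighbour at either end would prolong the longest path; at an interior
      vertex it would be a third neighbour.\<close>
    consider "Suc i = n" | "i = 0" | "0 < i" "Suc i < n" using iy(1) by linarith
    then show False
    proof cases
      case 1
      have "path (p(n := y)) (Suc n)"
        using inj pV edge iy 1 unfolding path_def
        by (auto simp: lessThan_Suc inj_on_def less_Suc_eq)
      then show False using max by fastforce
    next
      case 2
      have "mult S y (p 0) \<noteq> 0" using iy 2 by (simp add: mult_commute)
      then have "path (case_nat y p) (Suc n)"
        using inj mem edge iy unfolding path_def
        by (auto simp: inj_on_def split: nat.splits)
      then show False using max by fastforce
    next
      case 3
      then obtain k where k: "i = Suc k" using gr0_implies_Suc by blast
      have "p k \<noteq> y" "p (Suc i) \<noteq> y" using iy(3) 3 k by auto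
      then have "mult S (p i) (p k) + mult S (p i) (p (Suc i)) + mult S (p i) y \<le> 2"
        using val[OF mem[OF iy(1)], of "{p k, p (Suc i), y}"] neq[of k "Suc i"] iy 3 k mem
        by auto
      moreover have "mult S (p i) (p k) \<noteq> 0" "mult S (p i) (p (Suc i)) \<noteq> 0"
        using edge[of i] edge'[of k] 3 k by auto
      ultimately show False using iy(4) by linarith
    qed
  qed
  define ws where "ws = map (\<lambda>i. weight S (p i)) [0..<n]"
  have len: "length ws = n" by (simp add: ws_def)
  then have ws: "ws \<noteq> []" using n1 by auto
  have bij: "bij_betw p {..<n} (verts S)" using inj surj by (simp add: bij_betw_def)
  \<comment> \<open>With more than one vertex, every vertex has a path neighbour; a loop, adding 2
    to the degree, would exceed the bound.\<close>
  have loop: "mult S (p i) (p i) = 0" if "i < n" "1 < n" for i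
  proof -
    obtain j where j: "j < n" "j \<noteq> i" "mult S (p i) (p j) \<noteq> 0"
    proof (cases i)
      case 0
      then show ?thesis using that[of 1] edge[of 0] \<open>1 < n\<close> by auto
    next
      case (Suc k)
      then show ?thesis using that[of k] edge'[of k] \<open>i < n\<close> by auto
    qed
    have "mult S (p i) (p i) + mult S (p i) (p j) \<le> valency S (p i)"
      using mult_sum_le_valency[OF S(1), of "{p i, p j}" "p i"] neq[of i j] that j mem by auto
    then show ?thesis using deg[OF mem[OF that(1)]] j(3) by linarith
  qed
  have sym_eq: "mult S (p i) (p j) = mult K i j"
    if "i < n" "j < n" "\<And>i. i < n \<Longrightarrow> mult S (p i) (p i) = mult K i i"
      "\<And>i j. i < j \<Longrightarrow> j < n \<Longrightarrow> mult S (p i) (p j) = mult K i j"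
    for K :: "(nat, nat) wgraph" and i j
    using that mult_commute[of S "p i" "p j"] mult_commute[of K i j]
    by (cases i j rule: linorder_cases) auto
  have to_chain: "S \<cong> chain ws"
    if "\<And>i. i < n \<Longrightarrow> mult S (p i) (p i) = mult (chain ws) i i"
      "\<And>i j. i < j \<Longrightarrow> j < n \<Longrightarrow> mult S (p i) (p j) = mult (chain ws) i j"
  proof -
    have "iso_by p (chain ws) S"
      unfolding iso_by_def using bij sym_eq[OF _ _ that] by (auto simp: chain_def ws_def)
    then show ?thesis
      using iso_by_imp_isomorphic isomorphic_sym rational_chain[OF ws] S(1) by metis
  qed
  have to_cycle: "S \<cong> cycle ws"
    if "\<And>i. i < n \<Longrightarrow> mult S (p i) (p i) = mult (cycle ws) i i"
      "\<And>i j. i < j \<Longrightarrow> j < n \<Longrightarrow> mult S (p i) (p j) = mult (cycle ws) i j"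
  proof -
    have "iso_by p (cycle ws) S"
      unfolding iso_by_def using bij sym_eq[OF _ _ that] by (auto simp: cycle_def ws_def)
    then show ?thesis
      using iso_by_imp_isomorphic isomorphic_sym rational_cycle[OF ws] S(1) by metis
  qed
  have "S \<cong> chain ws \<or> S \<cong> cycle ws"
  proof (cases "n = 1")
    case True
    have "mult S (p 0) (p 0) \<le> valency S (p 0)" using mult_le_valency[OF S(1) mem] n1 by simp
    then have "mult S (p 0) (p 0) = 0 \<or> mult S (p 0) (p 0) = 1"
      using deg[OF mem[of 0]] n1 by auto
    then show ?thesis
      using to_chain to_cycle mult_chain[of 0 ws 0] mult_cycle_same[of 0 ws] True len by auto
  next
    case False
    then have n2: "1 < n" using n1 by simp
    have interior: "mult S (p i) (p j) = of_bool (j = Suc i \<or> i = Suc j)"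
      if i: "0 < i" "Suc i < n" and j: "j < n" for i j
    proof -
      obtain k where k: "i = Suc k" using i gr0_implies_Suc by blast
      have e: "mult S (p i) (p k) \<noteq> 0" "mult S (p i) (p (Suc i)) \<noteq> 0"
        using edge[of i] edge'[of k] i k by auto
      have "p k \<noteq> p (Suc i)" using neq i k by auto
      then have 2: "mult S (p i) (p k) + mult S (p i) (p (Suc i)) \<le> 2"
        using val[of "p i" "{p k, p (Suc i)}"] i k mem by auto
      show ?thesis
      proof (cases "j = k \<or> j = Suc i")
        case True
        then show ?thesis using e 2 k by auto
      next
        case False
        then have "mult S (p i) (p k) + (mult S (p i) (p (Suc i)) + mult S (p i) (p j)) \<le> 2"
          using val[of "p i" "{p k, p (Suc i), p j}"] neq[of k "Suc i"] neq[of k j] neq[of "Suc i" j]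
            i j k mem by auto
        then show ?thesis using e k False by auto
      qed
    qed
    show ?thesis
    \<comment> \<open>For two vertices the closing edge of the cycle is parallel to the path edge,
      so multiplicity 1 means chain and 2 means cycle.\<close>
    proof (cases "n = 2")
      case True
      have "mult S (p 0) (p 1) \<le> 2" using val[of "p 0" "{p 1}"] mem True by auto
      then consider "mult S (p 0) (p 1) = 1" | "mult S (p 0) (p 1) = 2"
        using edge[of 0] True by fastforce
      then show ?thesis
      proof cases
        case 1
        then show ?thesis
          using loop len True
          by (intro disjI1 to_chain) (auto simp: mult_chain less_Suc_eq numeral_2_eq_2)
      next
        case 2
        then show ?thesis
          using loop len True
          by (intro disjI2 to_cycle)
            (auto simp: mult_cycle mult_cycle_same less_Suc_eq numeral_2_eq_2)
      qed
    next
      case False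
      then have n3: "2 < n" using n2 by simp
      \<comment> \<open>Interior vertices have no valency left, so only the multiplicity between the
        two ends is open: 0 gives a chain, 1 a cycle.\<close>
      have pair: "mult S (p i) (p j) =
          (if i = 0 \<and> j = n - 1 then mult S (p 0) (p (n - 1)) else of_bool (j = Suc i))"
        if "i < j" "j < n" for i j
      proof (cases "0 < i")
        case True
        then show ?thesis using interior[of i j] that by auto
      next
        case False
        then show ?thesis
          using interior[of j i] that n3 by (cases "j = n - 1") (auto simp: mult_commute)
      qed
      have "mult S (p 0) (p 1) + mult S (p 0) (p (n - 1)) \<le> 2"
        using val[of "p 0" "{p 1, p (n - 1)}"] neq[of 1 "n - 1"] mem n3 by auto
      then consider "mult S (p 0) (p (n - 1)) = 0" | "mult S (p 0) (p (n - 1)) = 1"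
        using edge[of 0] n3 by fastforce
      then show ?thesis
      proof cases
        case 1
        have "mult S (p i) (p j) = mult (chain ws) i j" if "i < j" "j < n" for i j
          using pair[OF that] 1 that n3 len by (auto simp: mult_chain)
        then show ?thesis
          using loop n2 len by (intro disjI1 to_chain) (auto simp: mult_chain)
      next
        case 2
        have "mult S (p i) (p j) = mult (cycle ws) i j" if ij: "i < j" "j < n" for i j
        proof -
          have "Suc i mod n = Suc i" using ij by simp
          moreover have "i = Suc j mod n \<longleftrightarrow> i = 0 \<and> j = n - 1"
            using ij by (cases "Suc j = n") auto
          ultimately show ?thesis
            using pair[OF ij] 2 ij n3 len mult_cycle[of i ws j] by auto
        qed
        then show ?thesis
          using loop n2 len by (intro disjI2 to_cycle) (auto simp: mult_cycle_same)
      qed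
    qed
  qed
  then show ?thesis using ws unfolding is_linear_def is_circular_def by blast
qed

subsection \<open>Segments\<close>

lemma adjacent_iff: "rational_graph G \<Longrightarrow> adjacent G x y \<longleftrightarrow> mult G x y \<noteq> 0"
  using mult_pos_iff[of G x y] by (simp add: adjacent_def)

text \<open>If no edge led from \<open>B\<close> to the rest of \<open>A\<close>, membership in
  \<open>B\<close> would be constant along every path from \<open>u\<close>, making \<open>B\<close>
  empty or all of \<open>A\<close>.\<close>

lemma reachable_cut:
  assumes G: "rational_graph G" and u: "u \<in> verts G"
    and A: "A = {v \<in> verts G. (adjacent G)\<^sup>*\<^sup>* u v}" and B: "B \<subseteq> A" "B \<noteq> {}" "B \<noteq> A"
  shows "\<exists>x\<in>B. \<exists>y\<in>A - B. mult G x y \<noteq> 0"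
proof (rule ccontr)
  assume no: "\<not> ?thesis"
  have "w \<in> A \<and> (w \<in> B \<longleftrightarrow> u \<in> B)" if "(adjacent G)\<^sup>*\<^sup>* u w" for w
    using that
  proof (induction rule: rtranclp_induct)
    case base
    then show ?case using u A by simp
  next
    case (step y z)
    have yz: "mult G y z \<noteq> 0" "mult G z y \<noteq> 0"
      using step.hyps(2) adjacent_iff[OF G] by (simp_all add: mult_commute)
    then have "z \<in> verts G" using mult_outside[OF G, of z y] by auto
    then have "z \<in> A" using step.hyps A by (auto intro: rtranclp.rtrancl_into_rtrancl)
    then show ?case using step.IH yz no by blast
  qed
  then show False using A B by blast
qed

lemma connected_graph_cut_connected:
  assumes "rational_graph G" "connected_graph G"
  shows "cut_connected G"
proof -
  obtain u where u: "u \<in> verts G" using rational_graphD(2)[OF assms(1)] by blast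
  then have "verts G = {v \<in> verts G. (adjacent G)\<^sup>*\<^sup>* u v}"
    using assms(2) by (auto simp: connected_graph_def)
  then show ?thesis
    unfolding cut_connected_def using reachable_cut[OF assms(1) u] by blast
qed

lemma verts_induced [simp]: "verts (induced_subgraph G A) = verts G \<inter> A"
  and weight_induced [simp]: "weight (induced_subgraph G A) = weight G"
  by (simp_all add: induced_subgraph_def)

lemma rational_induced:
  assumes "rational_graph G" "verts G \<inter> A \<noteq> {}"
  shows "rational_graph (induced_subgraph G A)"
  using assms by (auto simp: rational_graph_def weighted_graph_def induced_subgraph_def)

lemma mult_induced:
  assumes "x \<in> A" "y \<in> A"
  shows "mult (induced_subgraph G A) x y = mult G x y"
proof -
  have "{e \<in> edges (induced_subgraph G A). ends (induced_subgraph G A) e = Upair x y} =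
      {e \<in> edges G. ends G e = Upair x y}"
    using assms by (auto simp: induced_subgraph_def)
  then show ?thesis by (simp add: mult_def)
qed

lemma segmentD:
  assumes G: "rational_graph G" and S: "S \<in> segments G"
  shows "rational_graph S" "cut_connected S" "verts S \<subseteq> verts G" "weight S = weight G"
    "\<And>x. x \<in> verts S \<Longrightarrow> \<not> branch_vertex G x"
    "\<And>x y. \<lbrakk>x \<in> verts S; y \<in> verts S\<rbrakk> \<Longrightarrow> mult S x y = mult G x y"
proof -
  define N where "N = {v. \<not> branch_vertex G v}"
  define K where "K = induced_subgraph G N"
  obtain u where u: "u \<in> verts K" and S_eq: "S = induced_subgraph K {v \<in> verts K. (adjacent K)\<^sup>*\<^sup>* u v}"
    using S unfolding segments_def components_def K_def N_def by blast
  define A where "A = {v \<in> verts K. (adjacent K)\<^sup>*\<^sup>* u v}"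
  have uA: "u \<in> A" using u by (simp add: A_def)
  have "verts K = verts G \<inter> N" by (simp add: K_def)
  then have A: "A \<subseteq> verts G" "A \<subseteq> N" "A \<subseteq> verts K" by (auto simp: A_def)
  have K: "rational_graph K" unfolding K_def using u by (intro rational_induced[OF G]) (auto simp: K_def)
  have SA: "S = induced_subgraph K A" using S_eq by (simp add: A_def)
  have vS: "verts S = A" using A by (auto simp: SA)
  show "rational_graph S" unfolding SA using uA u by (intro rational_induced[OF K]) auto
  show "verts S \<subseteq> verts G" "weight S = weight G" using A vS by (simp_all add: SA K_def)
  show "\<not> branch_vertex G x" if "x \<in> verts S" for x using that A vS by (auto simp: N_def)
  have mSK: "mult S x y = mult K x y" if "x \<in> verts S" "y \<in> verts S" for x y
    using that unfolding SA using vS SA by (intro mult_induced) auto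
  then show "mult S x y = mult G x y" if "x \<in> verts S" "y \<in> verts S" for x y
    using that A vS mult_induced[of x N y G] by (auto simp: K_def)
  show "cut_connected S"
    unfolding cut_connected_def
  proof (intro allI impI)
    fix B assume "B \<subseteq> verts S" "B \<noteq> {}" "B \<noteq> verts S"
    then obtain x y where xy: "x \<in> B" "y \<in> A - B" "mult K x y \<noteq> 0"
      using reachable_cut[OF K u A_def, of B] vS by blast
    then show "\<exists>x\<in>B. \<exists>y\<in>verts S - B. mult S x y \<noteq> 0"
      using mSK[of x y] vS \<open>B \<subseteq> verts S\<close> by (intro bexI[of _ x] bexI[of _ y]) auto
  qed
qed

lemma segment_exists:
  assumes "x \<in> verts G" "\<not> branch_vertex G x"
  obtains S where "S \<in> segments G" "x \<in> verts S"
proof -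
  define K where "K = induced_subgraph G {v. \<not> branch_vertex G v}"
  have "x \<in> verts K" using assms by (simp add: K_def)
  then have "induced_subgraph K {v \<in> verts K. (adjacent K)\<^sup>*\<^sup>* x v} \<in> segments G"
    "x \<in> verts (induced_subgraph K {v \<in> verts K. (adjacent K)\<^sup>*\<^sup>* x v})"
    unfolding segments_def components_def K_def by auto
  then show ?thesis by (rule that)
qed

lemma branch_vertex_iff:
  assumes "rational_graph G"
  shows "branch_vertex G x \<longleftrightarrow> x \<in> verts G \<and> 3 \<le> valency G x + mult G x x"
  using degree_eq[OF assms, of x] rational_graphD(5)[OF assms] by (auto simp: branch_vertex_def)

subsection \<open>Rigidity and admissibility\<close>

lemma rigid_chain_0: "rigid (chain [0])"
proof -
  have "mult (chain [0]) 0 0 = 0" by (simp add: mult_chain)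
  then show ?thesis by (simp add: rigid_def chain_def)
qed

lemma rigid_cycle_1: "w \<le> 4 \<Longrightarrow> rigid (cycle [w])"
proof -
  assume "w \<le> 4"
  moreover have "mult (cycle [w]) 0 0 = 1" by (simp add: mult_cycle_same)
  moreover have "verts (cycle [w]) = {0}" "weight (cycle [w]) 0 = w" by (auto simp: cycle_def)
  ultimately show ?thesis by (simp add: rigid_def)
qed

lemma rigid_cycle_2:
  assumes "m \<le> 0"
  shows "rigid (cycle [0, m])"
proof -
  define C where "C = cycle [0, m]"
  have "mult C 0 0 = 0" "mult C 1 1 = 0" "mult C 0 1 = 2" "mult C 1 0 = 2"
    by (simp_all add: C_def mult_cycle_same mult_cycle)
  moreover have "verts C = {0, 1}" "weight C 0 = 0" "weight C 1 = m"
    by (auto simp: C_def cycle_def)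
  ultimately have "rigid C" using assms by (simp add: rigid_def)
  then show ?thesis by (simp add: C_def)
qed

lemma admissible_rigid:
  assumes G: "rational_graph G" and adm: "admissible_mod_charm_earrings G"
  shows "rigid G"
  unfolding rigid_def
proof (intro ballI conjI impI; (elim conjE)?)
  fix x assume x: "x \<in> verts G" and lin: "mult G x x = 0" "valency G x \<le> 2" "0 \<le> weight G x"
  then obtain S where S: "S \<in> segments G" "x \<in> verts S"
    using segment_exists branch_vertex_iff[OF G] by (metis add_0_right not_less_eq_eq numeral_2_eq_2 numeral_3_eq_3)
  note D = segmentD[OF G S(1)]
  have "\<not> admissible_segment S"
  proof
    assume "admissible_segment S"
    \<comment> \<open>A nonnegative weight violates both bounds by -2. What remains is the
      one-vertex circular segment, whose loop contradicts \<open>lin\<close>.\<close>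
    then have "is_circular S" "\<exists>v. verts S = {v}"
      unfolding admissible_segment_def using S(2) lin D(4) by force+
    then obtain ws where ws: "ws \<noteq> []" "S \<cong> cycle ws" and vS: "verts S = {x}"
      unfolding is_circular_def using S(2) by auto
    then obtain f where f: "iso_by f S (cycle ws)"
      using isomorphic_iff[OF D(1) rational_cycle] by blast
    then have "card (verts (cycle ws)) = 1"
      using vS by (auto simp: iso_by_def dest: bij_betw_same_card)
    then have "length ws = 1" by (simp add: cycle_def)
    moreover have "f x < length ws" using f vS by (auto simp: iso_by_def cycle_def bij_betw_def)
    ultimately have "mult (cycle ws) (f x) (f x) = 1" by (simp add: mult_cycle_same)
    then have "mult S x x = 1" using f S(2) by (simp add: iso_by_def)
    then show False using D(6)[OF S(2) S(2)] lin by simp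
  qed
  then have "charm_earring G S" using adm S(1) by (simp add: admissible_mod_charm_earrings_def)
  then obtain b where b: "branch_vertex G b" "mult G x b = 2" and "weight G x = 0"
    using S(2) by (auto simp: charm_earring_def mult_def)
  show "weight G x = 0" by fact
  have bV: "b \<in> verts G" using b by (simp add: branch_vertex_def)
  show "even (mult G x y)" if "y \<in> verts G" for y
  proof (cases "y = b")
    case False
    then have "mult G x b + mult G x y \<le> 2"
      using mult_sum_le_valency[OF G, of "{b, y}" x] bV that lin by auto
    then show ?thesis using b by simp
  qed (use b in simp)
next
  fix x assume x: "x \<in> verts G" and loop: "mult G x x = 1" "valency G x = 1"
  then obtain S where S: "S \<in> segments G" "x \<in> verts S"
    using segment_exists[OF x] branch_vertex_iff[OF G, of x] by auto
  then have "admissible_segment S \<or> charm_earring G S"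
    using adm by (auto simp: admissible_mod_charm_earrings_def)
  then show "weight G x \<le> 4"
    using S(2) segmentD(4)[OF G S(1)] by (force simp: admissible_segment_def charm_earring_def)
qed

lemma singleton_isomorphic:
  assumes "rational_graph G" "rational_graph H" "verts G = {x}" "verts H = {y}"
    "weight G x = weight H y" "mult G x x = mult H y y"
  shows "G \<cong> H"
  using assms by (intro iso_by_imp_isomorphic[of _ _ "\<lambda>_. y"]) (auto simp: iso_by_def bij_betw_def)

lemma loop_isomorphic_cycle:
  assumes "rational_graph G" "verts G = {x}" "mult G x x = 1"
  shows "G \<cong> cycle [weight G x]"
proof -
  have "verts (cycle [w]) = {0}" "weight (cycle [w]) 0 = w" for w by (auto simp: cycle_def)
  then show ?thesis
    using assms rational_cycle[of "[weight G x]"] mult_cycle_same[of 0 "[weight G x]"]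
    by (intro singleton_isomorphic[of _ _ x 0]) auto
qed

lemma double_edge_isomorphic_cycle:
  assumes G: "rational_graph G" and V: "verts G = {x, y}" "x \<noteq> y" and w: "weight G x = 0"
    and m: "mult G x x = 0" "mult G y y = 0" "mult G x y = 2"
  shows "G \<cong> cycle [0, weight G y]"
proof -
  let ?C = "cycle [0, weight G y]"
  have "mult ?C 0 0 = 0" "mult ?C 1 1 = 0" "mult ?C 0 1 = 2" "mult ?C 1 0 = 2"
    by (simp_all add: mult_cycle_same mult_cycle)
  moreover have "verts ?C = {0, 1}" "weight ?C 0 = 0" "weight ?C 1 = weight G y"
    by (auto simp: cycle_def)
  moreover have "mult G y x = 2" using m by (simp add: mult_commute)
  ultimately have "iso_by (\<lambda>z. if z = x then 0 else 1) G ?C"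
    using V w m by (auto simp: iso_by_def bij_betw_def inj_on_def)
  then show ?thesis using iso_by_imp_isomorphic[OF G rational_cycle] by blast
qed

text \<open>A loop in a segment fills its vertex, so \<Gamma>-type graphs \<open>G\<close> with one
  reduce to a single looped vertex. Otherwise a non-admissible segment has a vertex of weight above
  -2, which is not -1 by minimality and so is 0 by rigidity. Without neighbours it gives [[0]]; with
  a double edge to \<open>y\<close> it is a charm earring if \<open>y\<close> is a branch vertex,
  and \<open>G\<close> is ((0,m)) if not.\<close>

lemma rigid_admissible:
  assumes G: "rational_graph G" "minimal G" "cut_connected G" and rig: "rigid G"
    and exc: "\<not> G \<cong> chain [0]" "\<not> G \<cong> cycle [3]" "\<not> G \<cong> cycle [4]"
      "\<And>m. m \<le> 0 \<Longrightarrow> \<not> G \<cong> cycle [0, m]"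
  shows "admissible_mod_charm_earrings G"
  unfolding admissible_mod_charm_earrings_def
proof (intro conjI ballI impI)
  fix S assume S: "S \<in> segments G" and nadm: "\<not> admissible_segment S"
  note D = segmentD[OF G(1) S]
  have deg: "valency G x + mult G x x \<le> 2" if "x \<in> verts S" for x
    using D(3,5) branch_vertex_iff[OF G(1), of x] that by fastforce
  \<comment> \<open>By connectedness, a nonempty vertex set that no edge leaves is
    everything.\<close>
  have all: "verts G = A" if "A \<subseteq> verts G" "A \<noteq> {}"
    "\<And>x y. \<lbrakk>x \<in> A; y \<in> verts G; y \<notin> A\<rbrakk> \<Longrightarrow> mult G x y = 0" for A
    using cut_connectedE[OF G(3) that(1,2)] that(3) by metis
  have mult_le: "mult G x y + mult G x z \<le> valency G x"
    if "y \<in> verts G" "z \<in> verts G" "y \<noteq> z" for x y z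
    using mult_sum_le_valency[OF G(1), of "{y, z}" x] that by auto
  have loopfree: "mult G x x = 0" if x: "x \<in> verts S" for x
  proof (rule ccontr)
    assume nz: "mult G x x \<noteq> 0"
    have xG: "x \<in> verts G" using x D(3) by auto
    have one: "mult G x x = 1" "valency G x = 1"
      using nz deg[OF x] mult_le_valency[OF G(1) xG, of x] by linarith+
    have V: "verts G = {x}"
    proof (rule all)
      show "mult G x' y = 0" if "x' \<in> {x}" "y \<in> verts G" "y \<notin> {x}" for x' y
        using mult_le[of x y x] xG that one by auto
    qed (use xG in auto)
    have "weight G x \<le> 4" using rigidD(3)[OF rig xG] one by simp
    moreover have "G \<cong> cycle [weight G x]" using loop_isomorphic_cycle[OF G(1) V one(1)] .
    \<comment> \<open>Excluding ((3)) and ((4)) lowers the bound 4 of rigidity to the bound 2 of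
      admissibility.\<close>
    ultimately have "weight G x \<le> 4" "weight G x \<noteq> 3" "weight G x \<noteq> 4" using exc(2,3) by auto
    then have "weight G x \<le> 2" by linarith
    moreover have vS: "verts S = {x}" using V x D(3) by auto
    moreover have "S \<cong> cycle [weight S x]"
      using loop_isomorphic_cycle[OF D(1) vS] D(6)[OF x x] one by simp
    ultimately show False
      using nadm D(4) unfolding admissible_segment_def is_circular_def by auto
  qed
  have "valency S x \<le> valency G x" if "x \<in> verts S" for x
  proof -
    have "valency S x = sum (mult G x) (verts S)"
      unfolding valency_def using that D(6) by (intro sum.cong) auto
    then show ?thesis using mult_sum_le_valency[OF G(1) D(3)] by simp
  qed
  then have "valency S x + mult S x x \<le> 2" if "x \<in> verts S" for x
    using that deg[OF that] D(6)[OF that that] by (metis add_le_mono1 order_trans)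
  then have "is_linear S \<or> is_circular S"
    using max_valency_2_classification[OF D(1,2)] by blast
  then obtain x where x: "x \<in> verts S" "- 2 < weight G x"
    using nadm D(4) unfolding admissible_segment_def by (metis linorder_not_less)
  have xG: "x \<in> verts G" using x D(3) by auto
  have val: "valency G x \<le> 2" and lx: "mult G x x = 0" using deg[OF x(1)] loopfree[OF x(1)] by auto
  have "weight G x \<noteq> -1" using G(2) minimal_iff[OF G(1)] xG val lx by blast
  then have pos: "0 \<le> weight G x" using x(2) by linarith
  then have w0: "weight G x = 0" and ev: "\<And>y. y \<in> verts G \<Longrightarrow> even (mult G x y)"
    using rigidD(1,2)[OF rig xG lx val] by auto
  obtain y where y: "y \<in> verts G" "mult G x y \<noteq> 0"
  proof (rule ccontr)
    assume "\<not> thesis"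
    then have none: "\<And>y. y \<in> verts G \<Longrightarrow> mult G x y = 0" using that by blast
    have V: "verts G = {x}" by (rule all) (use xG none in auto)
    have "verts (chain [0]) = {0}" "weight (chain [0]) 0 = 0" by (auto simp: chain_def)
    then have "G \<cong> chain [0]"
      using G(1) V w0 lx rational_chain[of "[0]"] mult_chain[of 0 "[0]" 0]
      by (intro singleton_isomorphic[of _ _ x 0]) auto
    then show False using exc(1) by blast
  qed
  have two: "mult G x y = 2"
    using ev[OF y(1)] y(2) mult_le_valency[OF G(1) y(1), of x] val by presburger
  have "x \<noteq> y" using y lx by auto
  have only: "mult G x z = 0" if "z \<in> verts G" "z \<noteq> y" for z
    using mult_le[OF y(1) that(1)] that(2) two val by (metis add_le_same_cancel1 le_trans le_zero_eq)
  have yx: "mult G y x = 2" using two by (simp add: mult_commute)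
  have branch: "branch_vertex G y"
  proof (rule ccontr)
    assume "\<not> branch_vertex G y"
    then have vy: "valency G y + mult G y y \<le> 2" using branch_vertex_iff[OF G(1), of y] y by simp
    have only': "mult G y z = 0" if "z \<in> verts G" "z \<noteq> x" for z
      using mult_le[OF xG that(1), of y] that(2) yx vy by simp
    have V: "verts G = {x, y}"
    proof (rule all)
      show "mult G x' z = 0" if "x' \<in> {x, y}" "z \<in> verts G" "z \<notin> {x, y}" for x' z
        using that only only' by auto
    qed (use xG y in auto)
    have ly: "mult G y y = 0" using only' y \<open>x \<noteq> y\<close> by auto
    \<comment> \<open>Rigidity at \<open>y\<close> turns a nonnegative weight into 0, so
      \<open>m\<close> is at most 0 and the excluded graph ((0,m)) arises.\<close>
    have "weight G y \<le> 0"
      using rigidD(1)[OF rig y(1) ly] vy by linarith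
    then show False
      using exc(4) double_edge_isomorphic_cycle[OF G(1) V \<open>x \<noteq> y\<close> w0 lx ly two] by blast
  qed
  have "verts S = {x}"
  proof (rule ccontr)
    assume "verts S \<noteq> {x}"
    then obtain z where "z \<in> verts S" "z \<noteq> x" "mult S x z \<noteq> 0"
      using cut_connectedE[OF D(2), of "{x}"] x(1) by (metis empty_not_insert empty_subsetI insert_subset singletonD)
    then have "mult G x z \<noteq> 0" "z \<in> verts G" "z \<noteq> y" using D(3,5,6) x(1) branch by auto
    then show False using only[of z] by simp
  qed
  moreover have "degree G x = 2"
    using degree_eq[OF G(1), of x] lx val mult_le_valency[OF G(1) y(1), of x] two by simp
  ultimately show "charm_earring G S"
    using S w0 xG rational_graphD(5)[OF G(1)] branch two unfolding charm_earring_def mult_def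
    by (intro conjI exI[of _ x] exI[of _ y]) simp_all
qed (rule G(2))

lemma rigid_iff:
  assumes "rational_graph G" "minimal G" "cut_connected G"
  shows "rigid G \<longleftrightarrow> \<not> (\<not> admissible_mod_charm_earrings G \<and> \<not> G \<cong> chain [0] \<and>
    \<not> G \<cong> cycle [3] \<and> \<not> G \<cong> cycle [4] \<and> (\<forall>m\<le>0. \<not> G \<cong> cycle [0, m]))"
proof -
  have iso: "rigid G" if "G \<cong> H" "rational_graph H" "rigid H" for H :: "(nat, nat) wgraph"
    using that isomorphic_iff[OF assms(1)] rigid_iso by blast
  have "rigid G" if "G \<cong> chain [0] \<or> G \<cong> cycle [3] \<or> G \<cong> cycle [4] \<or> (\<exists>m\<le>0. G \<cong> cycle [0, m])"
    using that iso[OF _ rational_chain rigid_chain_0] iso[OF _ rational_cycle rigid_cycle_1[of 3]]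
      iso[OF _ rational_cycle rigid_cycle_1[of 4]] iso[OF _ rational_cycle rigid_cycle_2]
    by auto
  then show ?thesis
    using admissible_rigid[OF assms(1)] rigid_admissible[OF assms] by blast
qed

theorem theorem7p0p8:
  fixes \<Gamma> :: "('v::infinite, 'e::infinite) wgraph"
  assumes "weighted_graph \<Gamma>"
    and "minimal \<Gamma>"
    and "connected_graph \<Gamma>"
    and "rational \<Gamma> = verts \<Gamma>"
  shows "((\<exists>\<S>. infinite \<S> \<and>
             (\<forall>G\<in>\<S>. birational \<Gamma> G \<and> weighted_graph G \<and> minimal G) \<and>
             (\<forall>G\<in>\<S>. \<forall>H\<in>\<S>. G \<noteq> H \<longrightarrow> \<not> G \<cong> H))
          \<longleftrightarrow>
          (\<not> admissible_mod_charm_earrings \<Gamma> \<and>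
             \<not> \<Gamma> \<cong> chain [0] \<and> \<not> \<Gamma> \<cong> cycle [3] \<and> \<not> \<Gamma> \<cong> cycle [4] \<and>
             (\<forall>m\<le>0. \<not> \<Gamma> \<cong> cycle [0, m])))
         \<and>
         (\<not> (\<not> admissible_mod_charm_earrings \<Gamma> \<and>
             \<not> \<Gamma> \<cong> chain [0] \<and> \<not> \<Gamma> \<cong> cycle [3] \<and> \<not> \<Gamma> \<cong> cycle [4] \<and>
             (\<forall>m\<le>0. \<not> \<Gamma> \<cong> cycle [0, m]))
          \<longrightarrow> (\<forall>G. birational \<Gamma> G \<and> weighted_graph G \<and> minimal G \<longrightarrow> \<Gamma> \<cong> G))"
    (is "(?inf \<longleftrightarrow> ?exc) \<and> (\<not> ?exc \<longrightarrow> ?uniq)")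
proof -
  have G: "rational_graph \<Gamma>" using assms by (simp add: rational_graph_def)
  have cut: "cut_connected \<Gamma>" using connected_graph_cut_connected[OF G assms(3)] .
  have exc: "rigid \<Gamma> \<longleftrightarrow> \<not> ?exc" using rigid_iff[OF G assms(2) cut] .
  have uniq: "\<Gamma> \<cong> K" if "rigid \<Gamma>" "birational \<Gamma> K" "minimal K" for K
    using rigid_unique_minimal[OF G assms(2)] that by blast
  have "\<not> ?inf" if rig: "rigid \<Gamma>"
  proof
    assume ?inf
    then obtain \<S> where S: "infinite \<S>" "\<And>K. K \<in> \<S> \<Longrightarrow> birational \<Gamma> K \<and> minimal K"
      "\<And>K L. \<lbrakk>K \<in> \<S>; L \<in> \<S>; K \<noteq> L\<rbrakk> \<Longrightarrow> \<not> K \<cong> L"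
      by blast
    obtain K where K: "K \<in> \<S>" using infinite_imp_nonempty[OF S(1)] by blast
    \<comment> \<open>Two distinct members already contradict uniqueness, since both are isomorphic
      to \<Gamma>.\<close>
    have "infinite (\<S> - {K})" using S(1) by simp
    then have "\<S> - {K} \<noteq> {}" by (rule infinite_imp_nonempty)
    then obtain L where L: "L \<in> \<S>" "L \<noteq> K" by blast
    have "rational_graph K" "rational_graph L"
      using birational_dominates[OF G assms(2) rig] dominates_rational S(2) K L by blast+
    moreover have "\<Gamma> \<cong> K" "\<Gamma> \<cong> L" using uniq[OF rig] S(2) K L by blast+
    ultimately have "K \<cong> L" using isomorphic_sym isomorphic_trans G by metis
    then show False using S(3) K L by blast
  qed
  moreover have ?inf if "\<not> rigid \<Gamma>"
    using not_rigid_unbounded[OF G cut that] by (rule unbounded_infinite_minimal)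
  ultimately show ?thesis using exc uniq by blast
qed

end
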